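(* There is an $O(|V|)$-time algorithm which, given an instance $\mathcal I$ of the Stable Roommates problem with Ties and Incomplete lists on agent set $V$ in which every preference list has length at most $2$, outputs a matching $M$ with $|bp(M)|=bp(\mathcal I)$.
   Context: An instance of the Stable Roommates problem with Ties and Incomplete lists (SRTI) consists of a graph $G=(V,E)$ whose vertices are agents, and for each agent $a_i$ a strict weak order on its neighbours in $G$ (ties allowed); $a_i$ strictly prefers $a_j$ to $a_k$ if $a_j$ precedes $a_k$ strictly. For a matching $M$, an edge $a_ia_j\notin M$ blocks $M$ if $a_i$ is unmatched or strictly prefers $a_j$ to $M(a_i)$, and $a_j$ is unmatched or strictly prefers $a_i$ to $M(a_j)$. $bp(M)$ is the set of blocking edges of $M$, and $bp(\mathcal I)$ is the minimum of $|bp(M')|$ over all matchings $M'$ of $\mathcal I$. *)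

theory Defs
  imports Complex_Main "HOL-Library.Landau_Symbols"
begin

section \<open>Stable Roommates with Ties and Incomplete lists\<close>

definition nbrs :: "'a set set \<Rightarrow> 'a \<Rightarrow> 'a set" where
  "nbrs E a = {b. {a, b} \<in> E}"

text \<open>\<open>prefers a b c\<close> means that \<open>a\<close> strictly prefers \<open>b\<close> to \<open>c\<close>; two neighbours that are
  incomparable for \<open>a\<close> are tied.\<close>

locale srti =
  fixes V :: "'a set" and E :: "'a set set" and prefers :: "'a \<Rightarrow> 'a \<Rightarrow> 'a \<Rightarrow> bool"
  assumes finite_agents: "finite V"
    and edges: "E \<subseteq> {{a, b} | a b. a \<in> V \<and> b \<in> V \<and> a \<noteq> b}"
    and pref_irrefl: "a \<in> V \<Longrightarrow> irreflp_on (nbrs E a) (prefers a)"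
    and pref_trans: "a \<in> V \<Longrightarrow> transp_on (nbrs E a) (prefers a)"
    and tie_trans:
      "a \<in> V \<Longrightarrow> transp_on (nbrs E a) (\<lambda>b c. \<not> prefers a b c \<and> \<not> prefers a c b)"

definition matching :: "'a set set \<Rightarrow> 'a set set \<Rightarrow> bool" where
  "matching E M \<longleftrightarrow> M \<subseteq> E \<and> (\<forall>e\<in>M. \<forall>f\<in>M. e \<noteq> f \<longrightarrow> e \<inter> f = {})"

definition partner :: "'a set set \<Rightarrow> 'a \<Rightarrow> 'a" where
  "partner M a = (THE b. {a, b} \<in> M)"

definition would_accept ::
    "('a \<Rightarrow> 'a \<Rightarrow> 'a \<Rightarrow> bool) \<Rightarrow> 'a set set \<Rightarrow> 'a \<Rightarrow> 'a \<Rightarrow> bool" where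
  "would_accept prefers M a b \<longleftrightarrow> a \<notin> \<Union>M \<or> prefers a b (partner M a)"

definition bp :: "'a set set \<Rightarrow> ('a \<Rightarrow> 'a \<Rightarrow> 'a \<Rightarrow> bool) \<Rightarrow> 'a set set \<Rightarrow> 'a set set" where
  "bp E prefers M =
     {{a, b} | a b. {a, b} \<in> E - M \<and> would_accept prefers M a b \<and> would_accept prefers M b a}"

definition min_bp :: "'a set set \<Rightarrow> ('a \<Rightarrow> 'a \<Rightarrow> 'a \<Rightarrow> bool) \<Rightarrow> nat" where
  "min_bp E prefers = Min {card (bp E prefers M) | M. matching E M}"

definition preference_list ::
    "'a set set \<Rightarrow> ('a \<Rightarrow> 'a \<Rightarrow> 'a \<Rightarrow> bool) \<Rightarrow> 'a \<Rightarrow> 'a list \<Rightarrow> bool" where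
  "preference_list E prefers a xs \<longleftrightarrow>
     distinct xs \<and> set xs = nbrs E a \<and> sorted_wrt (\<lambda>b c. \<not> prefers a c b) xs"


section \<open>A random-access machine\<close>

text \<open>Programs are while-programs over registers and arrays of natural numbers. Every operator,
  register access, array access and control decision takes one unit of time. The machine has words
  of \<open>w\<close> bits: an execution exists only if every value that occurs in it, including intermediate
  results and array indices, is less than \<open>2 ^ w\<close>.\<close>

record state =
  reg :: "string \<Rightarrow> nat"
  arr :: "string \<Rightarrow> nat \<Rightarrow> nat"

datatype aexp =
  Const nat | Reg string | Arr string aexp | Plus aexp aexp | Minus aexp aexp

datatype bexp =
  Eq aexp aexp | Less aexp aexp | BNot bexp | BAnd bexp bexp

datatype com =
    Skip
  | Assign string aexp
  | Store string aexp aexp  \<comment> \<open>array, index, value\<close>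
  | Seq com com
  | Cond bexp com com
  | While bexp com

primrec aval :: "state \<Rightarrow> aexp \<Rightarrow> nat" where
  "aval s (Const k) = k"
| "aval s (Reg x) = reg s x"
| "aval s (Arr x i) = arr s x (aval s i)"
| "aval s (Plus a b) = aval s a + aval s b"
| "aval s (Minus a b) = aval s a - aval s b"

primrec bval :: "state \<Rightarrow> bexp \<Rightarrow> bool" where
  "bval s (Eq a b) \<longleftrightarrow> aval s a = aval s b"
| "bval s (Less a b) \<longleftrightarrow> aval s a < aval s b"
| "bval s (BNot b) \<longleftrightarrow> \<not> bval s b"
| "bval s (BAnd b c) \<longleftrightarrow> bval s b \<and> bval s c"

primrec afits :: "nat \<Rightarrow> state \<Rightarrow> aexp \<Rightarrow> bool" where
  "afits w s (Const k) \<longleftrightarrow> k < 2 ^ w"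
| "afits w s (Reg x) \<longleftrightarrow> reg s x < 2 ^ w"
| "afits w s (Arr x i) \<longleftrightarrow> afits w s i \<and> arr s x (aval s i) < 2 ^ w"
| "afits w s (Plus a b) \<longleftrightarrow> afits w s a \<and> afits w s b \<and> aval s a + aval s b < 2 ^ w"
| "afits w s (Minus a b) \<longleftrightarrow> afits w s a \<and> afits w s b"

primrec bfits :: "nat \<Rightarrow> state \<Rightarrow> bexp \<Rightarrow> bool" where
  "bfits w s (Eq a b) \<longleftrightarrow> afits w s a \<and> afits w s b"
| "bfits w s (Less a b) \<longleftrightarrow> afits w s a \<and> afits w s b"
| "bfits w s (BNot b) \<longleftrightarrow> bfits w s b"
| "bfits w s (BAnd b c) \<longleftrightarrow> bfits w s b \<and> bfits w s c"

primrec acost :: "aexp \<Rightarrow> nat" where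
  "acost (Const k) = 1"
| "acost (Reg x) = 1"
| "acost (Arr x i) = acost i + 1"
| "acost (Plus a b) = acost a + acost b + 1"
| "acost (Minus a b) = acost a + acost b + 1"

primrec bcost :: "bexp \<Rightarrow> nat" where
  "bcost (Eq a b) = acost a + acost b + 1"
| "bcost (Less a b) = acost a + acost b + 1"
| "bcost (BNot b) = bcost b + 1"
| "bcost (BAnd b c) = bcost b + bcost c + 1"

definition set_reg :: "string \<Rightarrow> nat \<Rightarrow> state \<Rightarrow> state" where
  "set_reg x v s = s\<lparr>reg := (reg s)(x := v)\<rparr>"

definition set_arr :: "string \<Rightarrow> nat \<Rightarrow> nat \<Rightarrow> state \<Rightarrow> state" where
  "set_arr x i v s = s\<lparr>arr := (arr s)(x := (arr s x)(i := v))\<rparr>"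

text \<open>\<open>exec w c s t s'\<close>: on words of \<open>w\<close> bits, \<open>c\<close> started in \<open>s\<close> halts in \<open>s'\<close> after
  exactly \<open>t\<close> units of time.\<close>

inductive exec :: "nat \<Rightarrow> com \<Rightarrow> state \<Rightarrow> nat \<Rightarrow> state \<Rightarrow> bool" for w :: nat where
  exec_Skip: "exec w Skip s 1 s"
| exec_Assign: "afits w s a \<Longrightarrow> exec w (Assign x a) s (acost a + 1) (set_reg x (aval s a) s)"
| exec_Store: "afits w s i \<Longrightarrow> afits w s a \<Longrightarrow>
    exec w (Store x i a) s (acost i + acost a + 1) (set_arr x (aval s i) (aval s a) s)"
| exec_Seq: "exec w c s t s' \<Longrightarrow> exec w d s' u s'' \<Longrightarrow> exec w (Seq c d) s (t + u) s''"
| exec_CondTrue: "bfits w s b \<Longrightarrow> bval s b \<Longrightarrow> exec w c s t s' \<Longrightarrow>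
    exec w (Cond b c d) s (bcost b + 1 + t) s'"
| exec_CondFalse: "bfits w s b \<Longrightarrow> \<not> bval s b \<Longrightarrow> exec w d s t s' \<Longrightarrow>
    exec w (Cond b c d) s (bcost b + 1 + t) s'"
| exec_WhileFalse: "bfits w s b \<Longrightarrow> \<not> bval s b \<Longrightarrow> exec w (While b c) s (bcost b + 1) s"
| exec_WhileTrue: "bfits w s b \<Longrightarrow> bval s b \<Longrightarrow> exec w c s t s' \<Longrightarrow>
    exec w (While b c) s' u s'' \<Longrightarrow> exec w (While b c) s (bcost b + 1 + t + u) s''"

inductive_cases exec_SkipE: "exec w Skip s t s'"
inductive_cases exec_AssignE: "exec w (Assign x a) s t s'"
inductive_cases exec_StoreE: "exec w (Store x i a) s t s'"
inductive_cases exec_SeqE: "exec w (Seq c d) s t s'"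
inductive_cases exec_CondE: "exec w (Cond b c d) s t s'"
inductive_cases exec_WhileE: "exec w (While b c) s t s'"

lemma exec_deterministic:
  "exec w c s t s' \<Longrightarrow> exec w c s u s'' \<Longrightarrow> u = t \<and> s'' = s'"
proof (induction arbitrary: u s'' rule: exec.induct)
  case (exec_Skip s)
  then show ?case by (auto elim: exec_SkipE)
next
  case (exec_Assign s a x)
  from exec_Assign.prems show ?case by (rule exec_AssignE) simp
next
  case (exec_Store s i a x)
  from exec_Store.prems show ?case by (rule exec_StoreE) simp
next
  case (exec_Seq c s t s' d u' s2)
  from exec_Seq.prems obtain t1 s1 u1
    where "u = t1 + u1" "exec w c s t1 s1" "exec w d s1 u1 s''"
    by (rule exec_SeqE)
  with exec_Seq.IH(1)[of t1 s1] exec_Seq.IH(2)[of u1 s''] show ?case by simp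
next
  case (exec_CondTrue s b c t s' d)
  from exec_CondTrue.prems exec_CondTrue.hyps obtain t1
    where "u = bcost b + 1 + t1" "exec w c s t1 s''"
    by - (erule exec_CondE, simp_all)
  with exec_CondTrue.IH[of t1 s''] show ?case by simp
next
  case (exec_CondFalse s b d t s' c)
  from exec_CondFalse.prems exec_CondFalse.hyps obtain t1
    where "u = bcost b + 1 + t1" "exec w d s t1 s''"
    by - (erule exec_CondE, simp_all)
  with exec_CondFalse.IH[of t1 s''] show ?case by simp
next
  case (exec_WhileFalse s b c)
  from exec_WhileFalse.prems exec_WhileFalse.hyps show ?case
    by - (erule exec_WhileE, simp_all)
next
  case (exec_WhileTrue s b c t s' u' s2)
  from exec_WhileTrue.prems exec_WhileTrue.hyps obtain t1 s1 u1
    where "u = bcost b + 1 + t1 + u1" "exec w c s t1 s1" "exec w (While b c) s1 u1 s''"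
    by - (erule exec_WhileE, simp_all)
  with exec_WhileTrue.IH(1)[of t1 s1] exec_WhileTrue.IH(2)[of u1 s''] show ?case by simp
qed


section \<open>Input and output\<close>

text \<open>The agents are \<open>0, \<dots>, n - 1\<close>. The preference lists are stored one after another in the
  array \<open>nbr\<close>, the list of agent \<open>a\<close> beginning at index \<open>start[a]\<close>. Ties are recorded by \<open>rank\<close>:
  next to each list entry stands the number of neighbours that are strictly preferred to it. The
  order of tied agents within a list, and the contents of the rest of the memory, are
  arbitrary.\<close>

definition encodes_instance ::
    "nat \<Rightarrow> nat set set \<Rightarrow> (nat \<Rightarrow> nat \<Rightarrow> nat \<Rightarrow> bool) \<Rightarrow> state \<Rightarrow> bool" where
  "encodes_instance n E prefers s \<longleftrightarrow>
     reg s ''n'' = n \<and>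
     (\<exists>L. (\<forall>a<n. preference_list E prefers a (L a)) \<and>
        (\<forall>a\<le>n. arr s ''start'' a = (\<Sum>b<a. length (L b))) \<and>
        (\<forall>a<n. \<forall>i<length (L a).
           arr s ''nbr'' (arr s ''start'' a + i) = L a ! i \<and>
           arr s ''rank'' (arr s ''start'' a + i) = card {b \<in> nbrs E a. prefers a b (L a ! i)}))"

definition encodes_matching :: "nat \<Rightarrow> nat set set \<Rightarrow> state \<Rightarrow> bool" where
  "encodes_matching n M s \<longleftrightarrow>
     (\<forall>a<n. arr s ''mate'' a = (if a \<in> \<Union>M then partner M a else n))"

end

theory Submission imports Defs
begin

text \<open>As long as two unmatched agents are each a best choice of the other among the unmatched
  agents, match them: no edge at either of them can block any more. A stack of the agents whose
  choices may have changed makes this linear. When no such pair is left, the unmatched agents that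
  still have an unmatched neighbour form cycles in which everybody strictly prefers the successor
  to the predecessor. Matching consecutive agents along such a cycle leaves no agent unmatched if
  it is even, and one agent, hence one blocking edge, if it is odd. The latter cannot be avoided:
  a matching leaves some agent of an odd cycle unmatched, and this agent blocks with its
  predecessor.\<close>

section \<open>Greedy matchings in graphs of maximum degree two\<close>

text \<open>The lower bound must hold against every matching, also against those that ignore the
  greedy pairs. It does because an agent on a remaining cycle has both of its at most two neighbours
  on that cycle: the cycles are whole components of the graph, and every matching splits along them.
  The upper bound rests on an invariant that survives all later matches: no edge at a matched agent
  can ever block.

  Ties decide what "best" means: an agent tied between two unmatched neighbours accepts both as best
  choices. Hence no tie survives on a cycle, and the preference for the successor is strict there.

  Linearity comes from a potential. Matching a pair changes the choices of at most four other
  agents, which are pushed on the stack; at the same time two agents cease to be unmatched. Counting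
  one unit per stack entry and two per unmatched agent, a pop with a match changes the sum by -1 + 4
  - 4, a pop without one by -1. The sum starts at \<open>n + 2 * n\<close>.\<close>

text \<open>Agent \<open>x\<close> has first entry \<open>A x\<close> and second entry \<open>B x\<close> in its list, and \<open>n\<close> stands for
  a missing entry. A matching is a mate function \<open>m\<close>, with \<open>m x = n\<close> for unmatched \<open>x\<close>;
  \<open>m n \<noteq> n\<close> makes the missing entry look like an agent that is already matched.\<close>

locale short_lists = srti "{..<n}" E prefers
  for n :: nat and E :: "nat set set" and prefers :: "nat \<Rightarrow> nat \<Rightarrow> nat \<Rightarrow> bool" +
  fixes A B :: "nat \<Rightarrow> nat" and tied :: "nat \<Rightarrow> bool"
  assumes nbrs_eq: "x < n \<Longrightarrow> nbrs E x = {A x, B x} - {n}"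
    and A_n: "A n = n" and B_n: "B n = n"
    and A_neq_B: "x < n \<Longrightarrow> A x = B x \<Longrightarrow> A x = n"
    and not_prefers_B_A: "x < n \<Longrightarrow> A x \<noteq> n \<Longrightarrow> B x \<noteq> n \<Longrightarrow> \<not> prefers x (B x) (A x)"
    and tied_iff: "x < n \<Longrightarrow> A x \<noteq> n \<Longrightarrow> B x \<noteq> n \<Longrightarrow> tied x \<longleftrightarrow> \<not> prefers x (A x) (B x)"
begin

lemma edgeD: "{x, y} \<in> E \<Longrightarrow> x < n \<and> y < n \<and> x \<noteq> y"
  using edges by (fastforce simp: doubleton_eq_iff)

lemma edge_commute: "{x, y} \<in> E \<longleftrightarrow> {y, x} \<in> E"
  by (simp add: insert_commute)

lemma edge_iff: "x < n \<Longrightarrow> {x, y} \<in> E \<longleftrightarrow> y \<noteq> n \<and> (y = A x \<or> y = B x)"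
  using nbrs_eq[of x] by (auto simp: nbrs_def)

lemma A_le: "x \<le> n \<Longrightarrow> A x \<le> n"
  using edgeD[of x "A x"] edge_iff[of x "A x"] A_n by (cases "x = n"; cases "A x = n") simp_all

lemma B_le: "x \<le> n \<Longrightarrow> B x \<le> n"
  using edgeD[of x "B x"] edge_iff[of x "B x"] B_n by (cases "x = n"; cases "B x = n") simp_all

lemma prefers_irrefl: "{x, y} \<in> E \<Longrightarrow> \<not> prefers x y y"
  using edgeD[of x y] pref_irrefl[of x] by (auto simp: irreflp_on_def nbrs_def)

lemma prefers_asym:
  assumes "{x, y} \<in> E" "{x, z} \<in> E" "prefers x y z"
  shows "\<not> prefers x z y"
proof
  assume "prefers x z y"
  moreover have "transp_on (nbrs E x) (prefers x)" using pref_trans edgeD[OF assms(1)] by simp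
  moreover have "y \<in> nbrs E x" "z \<in> nbrs E x" using assms by (simp_all add: nbrs_def)
  ultimately have "prefers x y y" using assms(3) by (blast dest: transp_onD)
  then show False using prefers_irrefl[OF assms(1)] by simp
qed

lemma finite_E: "finite E"
proof (rule finite_subset)
  show "E \<subseteq> Pow {..<n}" using edges by auto
qed simp

section \<open>Mutually best pairs and the effect of matching one\<close>

definition best :: "(nat \<Rightarrow> nat) \<Rightarrow> nat \<Rightarrow> nat \<Rightarrow> bool" where
  "best m x y \<longleftrightarrow> m y = n \<and> (y = A x \<or> y = B x \<and> (m (A x) \<noteq> n \<or> tied x))"

text \<open>\<open>best m x y\<close> does not ask \<open>x\<close> itself to be unmatched; the
  converse half supplies \<open>m x = n\<close>. So neither a matched agent nor, as
  \<open>m n \<noteq> n\<close>, the placeholder \<open>n\<close> occurs in a mutual pair, and the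
  program may test any list entry without looking at it first.\<close>

definition mutual :: "(nat \<Rightarrow> nat) \<Rightarrow> nat \<Rightarrow> nat \<Rightarrow> bool" where
  "mutual m x y \<longleftrightarrow> best m x y \<and> best m y x"

definition valid :: "(nat \<Rightarrow> nat) \<Rightarrow> bool" where
  "valid m \<longleftrightarrow> m n \<noteq> n \<and> (\<forall>x<n. m x \<noteq> n \<longrightarrow> m (m x) = x \<and> {x, m x} \<in> E)"

text \<open>No edge at a matched agent blocks, not even in an extension of the matching.\<close>

definition stable :: "(nat \<Rightarrow> nat) \<Rightarrow> bool" where
  "stable m \<longleftrightarrow> (\<forall>x y. {x, y} \<in> E \<longrightarrow> m x \<noteq> n \<longrightarrow>
     \<not> prefers x y (m x) \<or> m y \<noteq> n \<and> \<not> prefers y x (m y))"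

definition link :: "nat \<Rightarrow> nat \<Rightarrow> (nat \<Rightarrow> nat) \<Rightarrow> nat \<Rightarrow> nat" where
  "link x y m = m(x := y, y := x)"

definition free :: "(nat \<Rightarrow> nat) \<Rightarrow> nat set" where
  "free m = {x. x < n \<and> m x = n}"

lemma finite_free: "finite (free m)"
  by (simp add: free_def)

lemma card_free_le: "card (free m) \<le> n"
  using card_mono[of "{..<n}" "free m"] by (auto simp: free_def)

lemma valid_le: "valid m \<Longrightarrow> x < n \<Longrightarrow> m x \<le> n"
  using edgeD[of x "m x"] by (force simp: valid_def)

lemma valid_link:
  assumes "valid m" "m x = n" "m y = n" "{x, y} \<in> E"
  shows "valid (link x y m)"
proof -
  have xy: "x < n" "y < n" "x \<noteq> y" using edgeD[OF assms(4)] by auto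
  \<comment> \<open>Mates are symmetric: if \<open>x\<close> or \<open>y\<close> were the mate of
    \<open>z\<close>, it would be matched itself.\<close>
  have 1: "m z \<noteq> x \<and> m z \<noteq> y" if "z < n" "m z \<noteq> n" for z
  proof -
    have "m (m z) \<noteq> n" using assms(1) that by (simp add: valid_def)
    then show ?thesis using assms by metis
  qed
  show ?thesis
    unfolding valid_def
  proof (intro conjI allI impI)
    show "link x y m n \<noteq> n" using assms(1) xy by (auto simp: valid_def link_def)
    fix z assume z: "z < n" "link x y m z \<noteq> n"
    consider "z = x" | "z = y" | "z \<noteq> x" "z \<noteq> y" "m z \<noteq> n"
      using z by (cases "z = x \<or> z = y") (auto simp: link_def)
    then have "link x y m (link x y m z) = z \<and> {z, link x y m z} \<in> E"
    proof cases
      case 3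
      then show ?thesis using assms(1) 1[of z] z by (auto simp: valid_def link_def)
    qed (use assms(4) xy edge_commute[of x y] in \<open>simp_all add: link_def\<close>)
    then show "link x y m (link x y m z) = z" "{z, link x y m z} \<in> E" by auto
  qed
qed

lemma free_link:
  assumes "m x = n" "m y = n" "{x, y} \<in> E"
  shows "card (free (link x y m)) + 2 = card (free m)"
proof -
  have xy: "x < n" "y < n" "x \<noteq> y" using edgeD[OF assms(3)] by auto
  have e: "free (link x y m) = free m - {x, y}"
    using xy by (auto simp: free_def link_def)
  have "{x, y} \<subseteq> free m" using xy assms by (auto simp: free_def)
  then have "card {x, y} \<le> card (free m)" "card (free m - {x, y}) = card (free m) - card {x, y}"
    by (auto intro!: card_mono card_Diff_subset simp: finite_free)
  then show ?thesis using xy e by simp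
qed

lemma mutual_edge:
  assumes "valid m" "mutual m x y" "x \<le> n" "y \<le> n"
  shows "m x = n" "m y = n" "{x, y} \<in> E"
proof -
  show 1: "m x = n" "m y = n" using assms by (auto simp: mutual_def best_def)
  then have "x < n" "y < n" using assms by (auto simp: valid_def le_less)
  then show "{x, y} \<in> E" using edge_iff[of x y] assms by (auto simp: mutual_def best_def)
qed

text \<open>The tie clause of \<open>best\<close> matters when \<open>y\<close> is the second entry
  and the first entry \<open>z\<close> is still unmatched: then \<open>y\<close> can be best only if
  \<open>x\<close> is tied.\<close>

lemma best_not_prefers:
  assumes "valid m" "best m x y" "{x, y} \<in> E" "{x, z} \<in> E" "m z = n"
  shows "\<not> prefers x z y"
proof -
  have "x < n" using edgeD assms by blast
  have n: "y \<noteq> n" "z \<noteq> n" using edgeD[OF assms(3)] edgeD[OF assms(4)] by auto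
  have y: "y = A x \<or> y = B x" and z: "z = A x \<or> z = B x"
    using edge_iff[OF \<open>x < n\<close>] assms by auto
  show ?thesis
  proof (cases "y = z")
    case True
    then show ?thesis using prefers_irrefl[OF assms(3)] by simp
  next
    case False
    then show ?thesis
      using y z n assms not_prefers_B_A[OF \<open>x < n\<close>] tied_iff[OF \<open>x < n\<close>]
      unfolding best_def by metis
  qed
qed

text \<open>An edge from the new pair to an agent matched earlier is refused at that other end:
  stability already held there while the near end was unmatched. An edge to an unmatched agent is
  refused by the near end, which has just received a best choice.\<close>

lemma stable_link:
  assumes "valid m" "stable m" "mutual m x y" "x \<le> n" "y \<le> n"
  shows "stable (link x y m)"
  unfolding stable_def
proof (intro allI impI)
  fix u v assume uv: "{u, v} \<in> E" and u: "link x y m u \<noteq> n"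
  note xy = mutual_edge[OF assms(1,3-5)]
  have yx: "{y, x} \<in> E" using xy edge_commute by blast
  have vu: "{v, u} \<in> E" using uv edge_commute by blast
  have old: "\<not> prefers v u (m v)" if "m u = n" "m v \<noteq> n"
    using assms(2) vu that by (auto simp: stable_def)
  have b: "best m x y" "best m y x" using assms(3) by (auto simp: mutual_def)
  consider "u \<noteq> x" "u \<noteq> y" | "u = x" "m v \<noteq> n" | "u = x" "m v = n"
    | "u = y" "m v \<noteq> n" | "u = y" "m v = n" by blast
  then show "\<not> prefers u v (link x y m u) \<or>
      link x y m v \<noteq> n \<and> \<not> prefers v u (link x y m v)"
  proof cases
    case 1
    then have "m u \<noteq> n" using u by (simp add: link_def)
    then have "\<not> prefers u v (m u) \<or> m v \<noteq> n \<and> \<not> prefers v u (m v)"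
      using assms(2) uv by (auto simp: stable_def)
    then show ?thesis using 1 xy by (auto simp: link_def)
  next
    case 2
    then show ?thesis using old xy by (auto simp: link_def)
  next
    case 3
    then show ?thesis using best_not_prefers[OF assms(1) b(1) xy(3), of v] uv edgeD[OF xy(3)]
      by (auto simp: link_def)
  next
    case 4
    then show ?thesis using old xy by (auto simp: link_def)
  next
    case 5
    then show ?thesis using best_not_prefers[OF assms(1) b(2) yx, of v] uv edgeD[OF xy(3)]
      by (auto simp: link_def)
  qed
qed

text \<open>A match only takes agents away, so a best choice is gained only when the first entry
  disappears and the second moves up. Then \<open>x\<close> or \<open>y\<close> was the first entry
  of \<open>u\<close>, which makes \<open>u\<close> one of the at most four neighbours of the
  pair.\<close>

lemma best_link_imp:
  assumes "valid m" "{x, y} \<in> E" "best (link x y m) u v" "m u = n" "u \<le> n"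
  shows "best m u v \<or> u \<in> {A x, B x, A y, B y}"
proof (rule disjCI)
  assume *: "u \<notin> {A x, B x, A y, B y}"
  have xy: "x < n" "y < n" "x \<noteq> y" using edgeD[OF assms(2)] by auto
  have u: "u < n" using assms by (auto simp: valid_def le_less)
  have 1: "A u \<noteq> x"
    using * edge_iff[OF u, of x] edge_iff[OF xy(1), of u] xy u edge_commute[of u x] by auto
  have 2: "A u \<noteq> y"
    using * edge_iff[OF u, of y] edge_iff[OF xy(2), of u] xy u edge_commute[of u y] by auto
  show "best m u v"
    using assms(3) 1 2 xy unfolding best_def link_def by (auto split: if_splits)
qed

lemma mutual_link_imp:
  assumes "valid m" "{x, y} \<in> E" "mutual (link x y m) u v" "u \<le> n" "v \<le> n"
  shows "u \<noteq> x \<and> u \<noteq> y \<and> v \<noteq> x \<and> v \<noteq> y \<and>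
    (mutual m u v \<or> u \<in> {A x, B x, A y, B y} \<or> v \<in> {A x, B x, A y, B y})"
proof -
  have xy: "x < n" "y < n" "x \<noteq> y" using edgeD[OF assms(2)] by auto
  have l: "link x y m u = n" "link x y m v = n"
    using assms(3) by (auto simp: mutual_def best_def)
  then have *: "u \<noteq> x" "u \<noteq> y" "v \<noteq> x" "v \<noteq> y" using xy by (auto simp: link_def split: if_splits)
  then have "m u = n" "m v = n" using l by (auto simp: link_def)
  then show ?thesis
    using * best_link_imp[OF assms(1,2), of u v] best_link_imp[OF assms(1,2), of v u] assms(3-5)
    unfolding mutual_def by blast
qed

end


section \<open>The remaining cycles\<close>

text \<open>When no mutually best pair is left, an unmatched agent \<open>x\<close> that still has an unmatched
  neighbour is not a best choice of its own best choice \<open>y\<close>. So \<open>x\<close> is the second entry of \<open>y\<close> and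
  \<open>y\<close> has both entries left. Thus \<open>x \<mapsto> y\<close> is injective, hence a permutation of the remaining agents
  with inverse \<open>B\<close>.\<close>

locale greedy_end = short_lists +
  fixes m\<^sub>1 :: "nat \<Rightarrow> nat"
  assumes valid1: "valid m\<^sub>1" and stable1: "stable m\<^sub>1"
    and no_mutual: "x \<le> n \<Longrightarrow> y \<le> n \<Longrightarrow> \<not> mutual m\<^sub>1 x y"
begin

definition S :: "nat set" where
  "S = {x. m\<^sub>1 x = n \<and> (\<exists>y. {x, y} \<in> E \<and> m\<^sub>1 y = n)}"

lemma S_lt: "x \<in> S \<Longrightarrow> x < n"
  using edgeD by (auto simp: S_def)

lemma S_free: "x \<in> S \<Longrightarrow> m\<^sub>1 x = n"
  by (auto simp: S_def)

lemma S_I: "{x, y} \<in> E \<Longrightarrow> m\<^sub>1 x = n \<Longrightarrow> m\<^sub>1 y = n \<Longrightarrow> x \<in> S \<and> y \<in> S"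
  using edge_commute by (auto simp: S_def)

lemma finite_S: "finite S"
  by (rule finite_subset[of _ "{..<n}"]) (auto simp: S_lt)

definition f :: "nat \<Rightarrow> nat" where
  "f x = (if m\<^sub>1 (A x) = n then A x else B x)"

lemma f_S:
  assumes "x \<in> S"
  shows "f x \<in> S" "m\<^sub>1 (A (f x)) = n" "B (f x) = x" "\<not> tied (f x)"
proof -
  have x: "x < n" "m\<^sub>1 x = n" using assms by (auto simp: S_lt S_free)
  obtain z where z: "{x, z} \<in> E" "m\<^sub>1 z = n" using assms by (auto simp: S_def)
  have fx: "m\<^sub>1 (f x) = n" using z edge_iff[OF x(1), of z] by (auto simp: f_def)
  have "f x \<noteq> n" using fx valid1 by (auto simp: valid_def)
  then have e: "{x, f x} \<in> E" using edge_iff[OF x(1), of "f x"] by (auto simp: f_def)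
  then show "f x \<in> S" using S_I fx x by blast
  have lt: "f x < n" using edgeD[OF e] by simp
  have "best m\<^sub>1 x (f x)" using fx by (auto simp: best_def f_def)
  then have nb: "\<not> best m\<^sub>1 (f x) x"
    using no_mutual[of x "f x"] lt x by (auto simp: mutual_def)
  have "x = A (f x) \<or> x = B (f x)" using edge_iff[OF lt, of x] e edge_commute[of x "f x"] by auto
  then show "B (f x) = x" "m\<^sub>1 (A (f x)) = n" "\<not> tied (f x)"
    using nb x by (auto simp: best_def)
qed

lemma f_image: "f ` S = S"
proof (rule endo_inj_surj[OF finite_S])
  show "f ` S \<subseteq> S" using f_S by auto
  show "inj_on f S" using f_S(3) by (metis inj_onI)
qed

text \<open>\<open>f\<close> is onto \<open>S\<close>, so every agent of \<open>S\<close> is a best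
  choice \<open>f x\<close>, and what \<open>f_S\<close> proves about best choices holds on all of
  \<open>S\<close>. In particular first entries are free there, hence \<open>f = A\<close> on
  \<open>S\<close>, with inverse \<open>B\<close>.\<close>

lemma S_cycle:
  assumes "y \<in> S"
  shows "A y \<in> S" "B y \<in> S" "A (B y) = y" "B (A y) = y" "A y \<noteq> y" "A y \<noteq> B y"
    "{y, A y} \<in> E" "{y, B y} \<in> E" "prefers y (A y) (B y)"
proof -
  have fA: "f z = A z" if "z \<in> S" for z
  proof -
    from that f_image obtain x where "x \<in> S" "z = f x" by auto
    then show ?thesis using f_S(2) by (simp add: f_def)
  qed
  from assms f_image obtain x where x: "x \<in> S" "y = f x" by auto
  have "y < n" using assms S_lt by simp
  show A: "A y \<in> S" using f_S(1)[OF assms] fA[OF assms] by simp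
  show B: "B y \<in> S" using f_S(3) x by simp
  show "A (B y) = y" using f_S(3) x fA by simp
  show "B (A y) = y" using f_S(3)[OF assms] fA[OF assms] by simp
  show eA: "{y, A y} \<in> E" using edge_iff[OF \<open>y < n\<close>] S_lt[OF A] by simp
  show eB: "{y, B y} \<in> E" using edge_iff[OF \<open>y < n\<close>] S_lt[OF B] by simp
  show "A y \<noteq> y" using edgeD eA by metis
  show "A y \<noteq> B y" using A_neq_B[OF \<open>y < n\<close>] S_lt[OF A] by auto
  show "prefers y (A y) (B y)"
    using tied_iff[OF \<open>y < n\<close>] f_S(4) x S_lt[OF A] S_lt[OF B] by auto
qed

text \<open>With \<open>S_cycle(1,2)\<close> no edge of the graph leaves \<open>S\<close>. This is
  what transfers statements about the cycles to arbitrary matchings.\<close>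

lemma S_edge: "x \<in> S \<Longrightarrow> {x, y} \<in> E \<longleftrightarrow> y = A x \<or> y = B x"
  using edge_iff S_lt S_cycle by (metis nat_neq_iff)

section \<open>Cycles as connected components\<close>

definition adj :: "(nat \<times> nat) set" where
  "adj = {(x, y). x \<in> S \<and> (y = A x \<or> y = B x)}"

lemma adj_in: "x \<in> S \<Longrightarrow> (x, A x) \<in> adj" "x \<in> S \<Longrightarrow> (x, B x) \<in> adj"
  by (auto simp: adj_def)

lemma adj_cases:
  assumes "(x, y) \<in> adj"
  obtains "x \<in> S" "y \<in> S" "y = A x" | "x \<in> S" "y \<in> S" "y = B x"
  using assms S_cycle(1,2) by (auto simp: adj_def)

lemma sym_adj: "sym adj"
proof (rule symI)
  fix x y assume "(x, y) \<in> adj"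
  then show "(y, x) \<in> adj"
    using adj_in[of y] S_cycle(3,4)[of x] by (cases rule: adj_cases) metis+
qed

definition comp :: "nat \<Rightarrow> nat set" where
  "comp x = {y. (x, y) \<in> adj\<^sup>*}"

lemma comp_refl: "x \<in> comp x"
  by (simp add: comp_def)

lemma comp_S: assumes "x \<in> S" shows "comp x \<subseteq> S"
proof
  fix y assume "y \<in> comp x"
  then have "(x, y) \<in> adj\<^sup>*" by (simp add: comp_def)
  then show "y \<in> S" using assms
    by (induction rule: rtrancl_induct) (blast elim: adj_cases)+
qed

lemma comp_eq: assumes "y \<in> comp x" shows "comp y = comp x"
proof -
  have xy: "(x, y) \<in> adj\<^sup>*" using assms by (simp add: comp_def)
  then have "(y, x) \<in> adj\<^sup>*" using sym_rtrancl[OF sym_adj] by (rule symD[rotated])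
  then show ?thesis using xy unfolding comp_def by (auto intro: rtrancl_trans)
qed

lemma comp_closed:
  assumes "y \<in> comp x" "x \<in> S" shows "A y \<in> comp x" "B y \<in> comp x"
proof -
  have "y \<in> S" using assms comp_S by auto
  then show "A y \<in> comp x" "B y \<in> comp x"
    using assms(1) adj_in[of y] by (auto simp: comp_def intro: rtrancl_into_rtrancl)
qed

text \<open>Closure under \<open>A\<close> alone suffices: \<open>A\<close> is injective and
  \<open>P\<close> finite, so \<open>A\<close> permutes \<open>P\<close>, and its inverse
  \<open>B\<close> stays inside \<open>P\<close> as well.\<close>

lemma comp_subset:
  assumes "x \<in> P" "P \<subseteq> S" "A ` P \<subseteq> P"
  shows "comp x \<subseteq> P"
proof
  fix y assume "y \<in> comp x"
  have "inj_on A P" using S_cycle(4) assms(2) by (metis inj_onI subsetD)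
  then have P: "A ` P = P"
    using assms(2,3) finite_S by (metis endo_inj_surj finite_subset)
  have BP: "B y \<in> P" if "y \<in> P" for y
  proof -
    from that P obtain z where "z \<in> P" "y = A z" by blast
    then show ?thesis using S_cycle(4)[of z] assms(2) by auto
  qed
  have "(x, y) \<in> adj\<^sup>*" using \<open>y \<in> comp x\<close> by (simp add: comp_def)
  then show "y \<in> P"
  proof (induction rule: rtrancl_induct)
    case base
    then show ?case using assms by simp
  next
    case (step u v)
    then show ?case using assms(3) BP by (blast elim: adj_cases)
  qed
qed

section \<open>Matching consecutive agents along the cycles\<close>

definition extends :: "(nat \<Rightarrow> nat) \<Rightarrow> bool" where
  "extends m \<longleftrightarrow> valid m \<and> (\<forall>x. x \<notin> S \<longrightarrow> m x = m\<^sub>1 x)"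

text \<open>The state of a finished cycle: its parity alone decides whether one agent or none is
  left unmatched.\<close>

definition closed :: "(nat \<Rightarrow> nat) \<Rightarrow> nat \<Rightarrow> bool" where
  "closed m z \<longleftrightarrow> (\<forall>u\<in>comp z. \<forall>v\<in>comp z. m u = n \<longrightarrow> m v = n \<longrightarrow> u = v)"

text \<open>Agents are matched in twos, whence the even exponent. The orbit may wrap around: once an
  even cycle is complete, \<open>x\<close> is \<open>a\<close> again.\<close>

definition walk :: "(nat \<Rightarrow> nat) \<Rightarrow> nat \<Rightarrow> nat \<Rightarrow> bool" where
  "walk m a x \<longleftrightarrow> (\<exists>k. x = (A ^^ (2 * k)) a \<and>
     {u \<in> comp a. m u \<noteq> n} = (\<lambda>i. (A ^^ i) a) ` {..<2 * k})"

text \<open>A cycle is entered at its smallest agent. When \<open>a\<close> reaches a later agent of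
  the same cycle, the alternative \<open>x = a \<and> closed m a\<close> applies; on a cycle not yet
  entered, the walk starts with \<open>k = 0\<close>.\<close>

definition walk_inv :: "(nat \<Rightarrow> nat) \<Rightarrow> nat \<Rightarrow> nat \<Rightarrow> bool" where
  "walk_inv m a x \<longleftrightarrow> a \<le> n \<and> x \<le> n \<and> extends m \<and>
     (\<forall>z\<in>S. z < a \<longrightarrow> closed m z) \<and>
     (\<forall>z\<in>S. z \<notin> comp a \<longrightarrow> closed m z \<or> (\<forall>u\<in>comp z. m u = n)) \<and>
     (if a \<in> S then walk m a x \<or> x = a \<and> closed m a else x = a)"

lemma walk_inv_init: "walk_inv m\<^sub>1 0 0"
proof -
  have "\<forall>u\<in>comp z. m\<^sub>1 u = n" if "z \<in> S" for z
    using comp_S[OF that] S_free by auto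
  moreover have "walk m\<^sub>1 0 0" if "0 \<in> S"
    unfolding walk_def using that calculation by (intro exI[of _ 0]) auto
  ultimately show ?thesis
    by (auto simp: walk_inv_def extends_def valid1)
qed

text \<open>Two mate lookups recognise a cycle, so the program never computes \<open>S\<close>:
  outside \<open>S\<close> the mates are those of \<open>m\<^sub>1\<close>, and two unmatched
  neighbours in \<open>m\<^sub>1\<close> both belong to \<open>S\<close> by definition.\<close>

lemma extends_free_edge:
  assumes "extends m" "x \<le> n" "m x = n" "m (A x) = n"
  shows "x \<in> S" "{x, A x} \<in> E"
proof -
  have "x < n" using assms by (auto simp: extends_def valid_def le_less)
  moreover have "A x \<noteq> n" using assms by (auto simp: extends_def valid_def)
  ultimately show e: "{x, A x} \<in> E" using edge_iff by simp
  show "x \<in> S"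
  proof (rule ccontr)
    assume x: "x \<notin> S"
    then have "m\<^sub>1 x = n" using assms by (simp add: extends_def)
    moreover have "m\<^sub>1 (A x) = n" using assms S_free by (cases "A x \<in> S") (auto simp: extends_def)
    ultimately show False using S_I e x by blast
  qed
qed

lemma extends_link:
  assumes "extends m" "x \<le> n" "m x = n" "m (A x) = n"
  shows "extends (link x (A x) m)"
  using valid_link[of m x "A x"] extends_free_edge[OF assms] assms S_cycle(1)[of x]
  by (auto simp: extends_def link_def)

lemma closed_or_untouched_link:
  assumes "x \<in> S" "z \<in> S" "x \<notin> comp z" "closed m z \<or> (\<forall>u\<in>comp z. m u = n)"
  shows "closed (link x (A x) m) z \<or> (\<forall>u\<in>comp z. link x (A x) m u = n)"
    "closed m z \<Longrightarrow> closed (link x (A x) m) z"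
proof -
  have "A x \<notin> comp z" using comp_closed(2)[of "A x" z] S_cycle(4)[OF assms(1)] assms by auto
  then have "link x (A x) m u = m u" if "u \<in> comp z" for u
    using that assms by (auto simp: link_def)
  then show "closed (link x (A x) m) z \<or> (\<forall>u\<in>comp z. link x (A x) m u = n)"
    "closed m z \<Longrightarrow> closed (link x (A x) m) z"
    using assms(4) by (auto simp: closed_def)
qed

lemma walk_in_comp: "a \<in> S \<Longrightarrow> (A ^^ i) a \<in> comp a"
  by (induction i) (auto simp: comp_refl comp_closed)

lemma closed_free_next:
  assumes "closed m a" "a \<in> S" "m a = n"
  shows "m (A a) \<noteq> n"
  using assms S_cycle(5)[of a] comp_refl[of a] comp_closed(1)[of a a]
  by (auto simp: closed_def)

text \<open>Two consecutive unmatched agents show that their cycle is not closed. So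
  \<open>x\<close> lies on the cycle being walked from \<open>a\<close>, no agent below
  \<open>a\<close> lies on that cycle, and all other cycles keep their mates.\<close>

lemma walk_inv_link:
  assumes "walk_inv m a x" "m x = n" "m (A x) = n"
  shows "walk_inv (link x (A x) m) a (A (A x))"
proof -
  let ?m = "link x (A x) m"
  have le: "a \<le> n" "x \<le> n" and ext: "extends m"
    and fin: "\<And>z. z \<in> S \<Longrightarrow> z < a \<Longrightarrow> closed m z"
    and oth: "\<And>z. z \<in> S \<Longrightarrow> z \<notin> comp a \<Longrightarrow> closed m z \<or> (\<forall>u\<in>comp z. m u = n)"
    and cur: "if a \<in> S then walk m a x \<or> x = a \<and> closed m a else x = a"
    using assms(1) unfolding walk_inv_def by blast+
  have xS: "x \<in> S" and e: "{x, A x} \<in> E" using extends_free_edge ext le assms by blast+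
  have aS: "a \<in> S" using cur xS by (auto split: if_splits)
  have "walk m a x" using cur aS closed_free_next[of m a] assms by auto
  then obtain k where k: "x = (A ^^ (2 * k)) a"
      "{u \<in> comp a. m u \<noteq> n} = (\<lambda>i. (A ^^ i) a) ` {..<2 * k}" by (auto simp: walk_def)
  have xc: "x \<in> comp a" using k walk_in_comp[OF aS] by simp
  then have Axc: "A x \<in> comp a" using comp_closed aS by simp
  have nc: "x \<notin> comp z" if "z \<notin> comp a" for z
    using that xc comp_eq comp_refl by metis
  have lt: "x < n" "A x < n" using edgeD[OF e] by auto
  have "{u \<in> comp a. ?m u \<noteq> n} = insert x (insert (A x) {u \<in> comp a. m u \<noteq> n})"
    using xc Axc lt by (auto simp: link_def)
  also have "\<dots> = (\<lambda>i. (A ^^ i) a) ` {..<2 * Suc k}"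
    using k by (simp add: lessThan_Suc) auto
  finally have w: "walk ?m a (A (A x))"
    unfolding walk_def using k(1) by (intro exI[of _ "Suc k"]) auto
  have not_closed: "\<not> closed m z" if "x \<in> comp z" "z \<in> S" for z
    using that comp_closed(1)[OF that] S_cycle(5)[OF xS] assms(2,3) unfolding closed_def by metis
  show ?thesis
    unfolding walk_inv_def
  proof (intro conjI ballI impI)
    show "a \<le> n" by (fact le)
    show "A (A x) \<le> n" using A_le le by simp
    show "extends ?m" using extends_link ext le assms by blast
    show "closed ?m z" if "z \<in> S" "z < a" for z
    proof -
      have c: "closed m z" using fin that by simp
      then have "x \<notin> comp z" using not_closed that by blast
      then show ?thesis using closed_or_untouched_link(2) xS that c by blast
    qed
    show "closed ?m z \<or> (\<forall>u\<in>comp z. ?m u = n)" if "z \<in> S" "z \<notin> comp a" for z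
      using closed_or_untouched_link(1)[OF xS that(1) nc[OF that(2)]] oth[OF that] by blast
    show "if a \<in> S then walk ?m a (A (A x)) \<or> A (A x) = a \<and> closed ?m a else A (A x) = a"
      using aS w by simp
  qed
qed

text \<open>The walk stops at a matched agent (even cycle) or at an unmatched one whose successor is
  matched (odd cycle). Either way the agents visited, including \<open>x\<close>, are closed under
  \<open>A\<close>; by \<open>comp_subset\<close> they form the whole cycle, and only
  \<open>x\<close> can be unmatched.\<close>

lemma walk_inv_next:
  assumes "walk_inv m a x" "\<not> (m x = n \<and> m (A x) = n)" "a < n"
  shows "walk_inv m (a + 1) (a + 1)"
proof -
  have le: "a \<le> n" "x \<le> n" and ext: "extends m"
    and fin: "\<And>z. z \<in> S \<Longrightarrow> z < a \<Longrightarrow> closed m z"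
    and oth: "\<And>z. z \<in> S \<Longrightarrow> z \<notin> comp a \<Longrightarrow> closed m z \<or> (\<forall>u\<in>comp z. m u = n)"
    and cur: "if a \<in> S then walk m a x \<or> x = a \<and> closed m a else x = a"
    using assms(1) unfolding walk_inv_def by blast+
  have ca: "closed m a" if aS: "a \<in> S"
  proof (cases "walk m a x")
    case True
    then obtain k where k: "x = (A ^^ (2 * k)) a"
      and mk: "{u \<in> comp a. m u \<noteq> n} = (\<lambda>i. (A ^^ i) a) ` {..<2 * k}" by (auto simp: walk_def)
    let ?P = "(\<lambda>i. (A ^^ i) a) ` {..2 * k}"
    have step: "A ((A ^^ i) a) \<in> ?P" if "i < 2 * k" for i
      using that by (intro image_eqI[of _ _ "Suc i"]) auto
    have inP: "u \<in> ?P" if "u \<in> comp a" "m u \<noteq> n" for u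
    proof -
      have "u \<in> (\<lambda>i. (A ^^ i) a) ` {..<2 * k}" using that mk by blast
      then show ?thesis by auto
    qed
    have xc: "x \<in> comp a" using k walk_in_comp[OF aS] by simp
    have Ax: "A x \<in> ?P"
    proof (cases "m x = n")
      case True
      then show ?thesis using inP comp_closed(1)[OF xc aS] assms(2) by simp
    next
      case False
      then have "x \<in> (\<lambda>i. (A ^^ i) a) ` {..<2 * k}" using xc mk by blast
      then show ?thesis using step by auto
    qed
    have "A ((A ^^ i) a) \<in> ?P" if "i \<le> 2 * k" for i
      using that Ax step[of i] k by (cases "i = 2 * k") auto
    then have P3: "A ` ?P \<subseteq> ?P" by auto
    have P2: "?P \<subseteq> S" using walk_in_comp[OF aS] comp_S[OF aS] by auto
    have P1: "a \<in> ?P" by (rule image_eqI[of _ _ 0]) auto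
    note cP = comp_subset[OF P1 P2 P3]
    have "{..2 * k} = insert (2 * k) {..<2 * k}" by auto
    then have "?P = insert x ((\<lambda>i. (A ^^ i) a) ` {..<2 * k})"
      using k by (simp only: image_insert)
    then have "comp a \<subseteq> insert x {u \<in> comp a. m u \<noteq> n}" using mk cP by simp
    then show ?thesis unfolding closed_def by blast
  next
    case False
    then show ?thesis using cur aS by simp
  qed
  have all: "closed m z \<or> (\<forall>u\<in>comp z. m u = n)" if "z \<in> S" for z
  proof (cases "z \<in> comp a")
    case True
    then have "comp z = comp a" "a \<in> S"
      using comp_eq comp_refl comp_S[OF that] by blast+
    then show ?thesis using ca by (simp add: closed_def)
  next
    case False
    then show ?thesis using oth that by simp
  qed
  show ?thesis
    unfolding walk_inv_def
  proof (intro conjI ballI impI)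
    show "a + 1 \<le> n" "a + 1 \<le> n" using assms(3) by auto
    show "closed m z" if "z \<in> S" "z < a + 1" for z
      using that fin ca by (cases "z = a") auto
    show "if a + 1 \<in> S then walk m (a + 1) (a + 1) \<or> a + 1 = a + 1 \<and> closed m (a + 1)
        else a + 1 = a + 1"
    proof (cases "a + 1 \<in> S \<and> \<not> closed m (a + 1)")
      case True
      then have "\<forall>u\<in>comp (a + 1). m u = n" using all by blast
      then have "walk m (a + 1) (a + 1)" unfolding walk_def by (intro exI[of _ 0]) simp
      then show ?thesis by simp
    qed simp
  qed (use ext all in auto)
qed

lemma walk_inv_end:
  assumes "walk_inv m n x"
  shows "extends m" "z \<in> S \<Longrightarrow> closed m z"
  using assms S_lt unfolding walk_inv_def by blast+

end


section \<open>Optimality\<close>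

lemma even_card_involution:
  assumes "finite X" "\<And>x. x \<in> X \<Longrightarrow> g x \<in> X \<and> g (g x) = x \<and> g x \<noteq> x"
  shows "even (card X)"
  using assms
proof (induction "card X" arbitrary: X rule: less_induct)
  case less
  show ?case
  proof (cases "X = {}")
    case False
    then obtain x where x: "x \<in> X" by auto
    let ?Y = "X - {x, g x}"
    have g: "g x \<in> X" "g x \<noteq> x" "g (g x) = x" using less.prems x by auto
    have sub: "{x, g x} \<subseteq> X" using x g by simp
    have c2: "card {x, g x} = 2" using g(2) by auto
    have c: "card ?Y + 2 = card X"
      using card_Diff_subset[OF _ sub] card_mono[OF less.prems(1) sub] c2 by simp
    have "even (card ?Y)"
    proof (rule less.hyps)
      show "card ?Y < card X" using c by simp
      show "finite ?Y" using less.prems by simp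
      show "g y \<in> ?Y \<and> g (g y) = y \<and> g y \<noteq> y" if "y \<in> ?Y" for y
        using that less.prems(2)[of y] g by auto
    qed
    then show ?thesis using c by presburger
  qed simp
qed

lemma partner_eq:
  assumes "matching E M" "{x, y} \<in> M"
  shows "partner M x = y"
  unfolding partner_def
proof (rule the_equality)
  fix z assume z: "{x, z} \<in> M"
  then have "{x, y} = {x, z}" using assms unfolding matching_def by (metis Int_iff empty_iff insertI1)
  then show "z = y" by (auto simp: doubleton_eq_iff)
qed (fact assms)

context short_lists
begin

lemma matchedE:
  assumes "matching E M" "x \<in> \<Union>M"
  obtains "{x, partner M x} \<in> M" "{x, partner M x} \<in> E"
proof -
  obtain e where e: "e \<in> M" "x \<in> e" using assms by auto
  then have "e \<in> E" using assms by (auto simp: matching_def)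
  then obtain a b where "e = {a, b}" using edges by blast
  then obtain y where "e = {x, y}" using e by auto
  then show thesis
    using that e partner_eq[OF assms(1), of x y] \<open>e \<in> E\<close> by auto
qed

section \<open>From mate functions to sets of edges\<close>

definition edges_of :: "(nat \<Rightarrow> nat) \<Rightarrow> nat set set" where
  "edges_of m = {{x, m x} | x. x < n \<and> m x \<noteq> n}"

context
  fixes m assumes valid: "valid m"
begin

lemma edges_of_iff: "{x, y} \<in> edges_of m \<longleftrightarrow> x < n \<and> m x \<noteq> n \<and> y = m x"
proof
  assume "{x, y} \<in> edges_of m"
  then obtain z where z: "{x, y} = {z, m z}" "z < n" "m z \<noteq> n" by (auto simp: edges_of_def)
  then have "m (m z) = z" "m z < n" using valid edgeD by (auto simp: valid_def)
  then show "x < n \<and> m x \<noteq> n \<and> y = m x" using z by (auto simp: doubleton_eq_iff)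
qed (auto simp: edges_of_def)

lemma edges_ofD:
  assumes "e \<in> edges_of m" "u \<in> e"
  shows "e = {u, m u}"
proof -
  obtain x where x: "e = {x, m x}" "x < n" "m x \<noteq> n" using assms by (auto simp: edges_of_def)
  then have "m (m x) = x" using valid by (simp add: valid_def)
  then show ?thesis using x(1) assms(2) by (metis insertE insert_commute singletonD)
qed

lemma matching_edges_of: "matching E (edges_of m)"
  unfolding matching_def
proof (intro conjI ballI impI)
  show "edges_of m \<subseteq> E" using valid by (auto simp: valid_def edges_of_def)
  fix e e' assume "e \<in> edges_of m" "e' \<in> edges_of m" "e \<noteq> e'"
  then show "e \<inter> e' = {}" using edges_ofD by blast
qed

lemma Union_edges_of: "x \<in> \<Union>(edges_of m) \<longleftrightarrow> x < n \<and> m x \<noteq> n"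
proof
  assume "x \<in> \<Union>(edges_of m)"
  then obtain y where y: "x = y \<or> x = m y" "y < n" "m y \<noteq> n" by (auto simp: edges_of_def)
  have "m (m y) = y" "m y < n" using valid y edgeD[of y "m y"] by (simp_all add: valid_def)
  then show "x < n \<and> m x \<noteq> n" using y by auto
qed (auto simp: edges_of_def)

lemma partner_edges_of: "x < n \<Longrightarrow> m x \<noteq> n \<Longrightarrow> partner (edges_of m) x = m x"
  using partner_eq[OF matching_edges_of] edges_of_iff by blast

lemma would_accept_edges_of:
  "x < n \<Longrightarrow> would_accept prefers (edges_of m) x y \<longleftrightarrow> m x = n \<or> prefers x y (m x)"
  by (cases "m x = n")
    (simp_all add: would_accept_def Union_edges_of partner_edges_of del: Union_iff)

lemma encodes_edges_of: "arr s ''mate'' = m \<Longrightarrow> encodes_matching n (edges_of m) s"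
  by (simp add: encodes_matching_def Union_edges_of partner_edges_of del: Union_iff)

end

end

section \<open>Upper and lower bounds on the blocking edges\<close>

context greedy_end
begin

text \<open>The only other possible partner is the successor \<open>A z\<close>, which
  \<open>z\<close> strictly prefers. So a cycle edge can block only if the agent at its head is
  unmatched.\<close>

lemma S_not_accepts_B:
  assumes "matching E M" "z \<in> S" "z \<in> \<Union>M" "{z, B z} \<notin> M"
  shows "\<not> would_accept prefers M z (B z)"
proof -
  have p: "{z, partner M z} \<in> M" "{z, partner M z} \<in> E" using matchedE assms by blast+
  then have "partner M z = A z" using S_edge[OF assms(2)] assms(4) by auto
  then show ?thesis
    using prefers_asym[of z "A z" "B z"] S_cycle[OF assms(2)] assms(3)
    by (simp add: would_accept_def)
qed

text \<open>The predecessor misses its strict first choice \<open>z\<close>; it is unmatched or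
  holds its second choice, and would switch in both cases.\<close>

lemma bp_unmatched:
  assumes "matching E M" "z \<in> S" "z \<notin> \<Union>M"
  shows "{B z, z} \<in> bp E prefers M"
proof -
  let ?p = "B z"
  have p: "?p \<in> S" "A ?p = z" using S_cycle[OF assms(2)] by auto
  have e: "{?p, z} \<in> E" using S_cycle(7)[OF p(1)] p by simp
  have "would_accept prefers M ?p z"
  proof (cases "?p \<in> \<Union>M")
    case True
    then have q: "{?p, partner M ?p} \<in> M" "{?p, partner M ?p} \<in> E" using matchedE assms by blast+
    then have "partner M ?p = B ?p" using S_edge[OF p(1)] p(2) assms(3) by auto
    then show ?thesis using S_cycle(9)[OF p(1)] p(2) by (simp add: would_accept_def)
  qed (simp add: would_accept_def)
  moreover have "would_accept prefers M z ?p" "{?p, z} \<notin> M"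
    using assms(3) by (auto simp: would_accept_def)
  ultimately show ?thesis using e unfolding bp_def by blast
qed

text \<open>An edge on a cycle joins some agent to its predecessor, and
  \<open>S_not_accepts_B\<close> applies to that agent. An edge off the cycles has an end matched by
  \<open>m\<^sub>1\<close>, and \<open>stable1\<close> excludes that it blocks.\<close>

lemma bp_subset:
  assumes "extends m"
  shows "bp E prefers (edges_of m) \<subseteq> (\<lambda>z. {B z, z}) ` {z \<in> S. m z = n}"
proof
  fix e assume "e \<in> bp E prefers (edges_of m)"
  have v: "valid m" using assms by (simp add: extends_def)
  from \<open>e \<in> _\<close> obtain x y where e: "e = {x, y}" "{x, y} \<in> E" "{x, y} \<notin> edges_of m"
      and w: "would_accept prefers (edges_of m) x y" "would_accept prefers (edges_of m) y x"
    unfolding bp_def by blast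
  have lt: "x < n" "y < n" using edgeD[OF e(2)] by auto
  note w' = w(1)[unfolded would_accept_edges_of[OF v lt(1)]]
    w(2)[unfolded would_accept_edges_of[OF v lt(2)]]
  have key: "e \<in> (\<lambda>z. {B z, z}) ` {z \<in> S. m z = n}"
    if "z \<in> S" "e = {z, B z}" "would_accept prefers (edges_of m) z (B z)" for z
  proof -
    have "z \<notin> \<Union>(edges_of m)"
      using S_not_accepts_B[OF matching_edges_of[OF v] that(1)] that e by auto
    then have "m z = n" using Union_edges_of[OF v] S_lt[OF that(1)] by auto
    then show ?thesis using that by (auto simp: insert_commute)
  qed
  show "e \<in> (\<lambda>z. {B z, z}) ` {z \<in> S. m z = n}"
  proof (cases "x \<in> S")
    case True
    consider "y = A x" | "y = B x" using S_edge[OF True] e by auto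
    then show ?thesis
    proof cases
      case 1
      then have "y \<in> S" "x = B y" using S_cycle[OF True] by auto
      then show ?thesis using key[of y] e w by (auto simp: insert_commute)
    next
      case 2
      then show ?thesis using key[of x] True e w by auto
    qed
  next
    case False
    then have "y \<notin> S" using S_edge[of y x] S_cycle e edge_commute by blast
    then have "m x = m\<^sub>1 x" "m y = m\<^sub>1 y" using False assms by (auto simp: extends_def)
    moreover have "m\<^sub>1 x \<noteq> n \<or> m\<^sub>1 y \<noteq> n" using S_I e False by blast
    ultimately have False
      using w' stable1 e(2) edge_commute[of x y] unfolding stable_def by metis
    then show ?thesis ..
  qed
qed

text \<open>Matching edges at the cycle stay on it, so \<open>partner M\<close> is an involution
  without fixed points on its matched agents.\<close>

lemma even_matched_comp:
  assumes "matching E M" "a \<in> S"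
  shows "even (card {z \<in> comp a. z \<in> \<Union>M})"
proof (rule even_card_involution[where g = "partner M"])
  show "finite {z \<in> comp a. z \<in> \<Union>M}"
    using comp_S[OF assms(2)] finite_S by (auto intro: finite_subset)
  fix z assume "z \<in> {z \<in> comp a. z \<in> \<Union>M}"
  then have z: "z \<in> comp a" "z \<in> \<Union>M" by auto
  have zS: "z \<in> S" using z comp_S assms by blast
  have p: "{z, partner M z} \<in> M" "{z, partner M z} \<in> E" using matchedE assms z by blast+
  have "partner M z \<in> comp a" using S_edge[OF zS] p comp_closed[OF z(1) assms(2)] by auto
  moreover have "partner M (partner M z) = z"
    using partner_eq[OF assms(1)] p by (metis insert_commute)
  moreover have "partner M z \<noteq> z" using edgeD[OF p(2)] by auto
  ultimately show "partner M z \<in> {z \<in> comp a. z \<in> \<Union>M} \<and>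
      partner M (partner M z) = z \<and> partner M z \<noteq> z"
    using p by auto
qed

text \<open>A cycle with exactly one unmatched agent is odd, so every matching leaves one of its agents
  unmatched.\<close>

lemma unmatched_in_comp:
  assumes "extends m" "closed m a" "a \<in> S" "m a = n" "matching E M"
  shows "\<exists>z\<in>comp a. z \<notin> \<Union>M"
proof (rule ccontr)
  assume "\<not> ?thesis"
  then have "{z \<in> comp a. z \<in> \<Union>M} = comp a" by auto
  then have 1: "even (card (comp a))" using even_matched_comp[OF assms(5,3)] by simp
  have v: "valid m" using assms by (simp add: extends_def)
  have "{z \<in> comp a. z \<in> \<Union>(edges_of m)} = comp a - {a}"
    using Union_edges_of[OF v] assms(2,4) comp_refl[of a] comp_S[OF assms(3)] S_lt
    unfolding closed_def by blast
  then have "even (card (comp a - {a}))"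
    using even_matched_comp[OF matching_edges_of[OF v] assms(3)] by simp
  moreover have "finite (comp a)" using comp_S[OF assms(3)] finite_S by (rule finite_subset)
  then have "card (comp a) = Suc (card (comp a - {a}))"
    using comp_refl card.remove by metis
  ultimately show False using 1 by simp
qed

text \<open>Both sides are compared with \<open>card ?U\<close>, the number of odd cycles. For the
  lower bound, \<open>g\<close> picks on each of them an agent that \<open>M\<close> leaves
  unmatched.\<close>

lemma bp_le:
  assumes "extends m" "\<And>z. z \<in> S \<Longrightarrow> closed m z" "matching E M"
  shows "card (bp E prefers (edges_of m)) \<le> card (bp E prefers M)"
proof -
  let ?U = "{z \<in> S. m z = n}"
  have fin: "finite ?U" using finite_S by simp
  have "\<forall>a\<in>?U. \<exists>z\<in>comp a. z \<notin> \<Union>M" using unmatched_in_comp assms by simp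
  then obtain g where g: "\<And>a. a \<in> ?U \<Longrightarrow> g a \<in> comp a \<and> g a \<notin> \<Union>M" by metis
  have gS: "g a \<in> S" if "a \<in> ?U" for a using g[OF that] comp_S[of a] that by auto
  have sub: "{B (g a), g a} \<subseteq> comp a" if "a \<in> ?U" for a
    using g[OF that] comp_closed that by auto
  \<comment> \<open>Equal edges lie on the same cycle, and a closed cycle has at most one agent in
    \<open>?U\<close>.\<close>
  have inj: "inj_on (\<lambda>a. {B (g a), g a}) ?U"
  proof (rule inj_onI)
    fix a b assume ab: "a \<in> ?U" "b \<in> ?U" "{B (g a), g a} = {B (g b), g b}"
    then have "g a \<in> comp a" "g a \<in> comp b" using sub[OF ab(1)] sub[OF ab(2)] by blast+
    then have "comp a = comp b" using comp_eq by metis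
    then show "a = b" using assms(2)[of a] ab comp_refl unfolding closed_def by blast
  qed
  have finbp: "finite (bp E prefers M)"
    by (rule finite_subset[OF _ finite_E]) (auto simp: bp_def)
  have "card ?U = card ((\<lambda>a. {B (g a), g a}) ` ?U)"
    by (rule card_image[OF inj, symmetric])
  also have "\<dots> \<le> card (bp E prefers M)"
  proof (rule card_mono[OF finbp])
    show "(\<lambda>a. {B (g a), g a}) ` ?U \<subseteq> bp E prefers M"
      using bp_unmatched[OF assms(3)] gS g by auto
  qed
  finally have le: "card ?U \<le> card (bp E prefers M)" .
  have "card (bp E prefers (edges_of m)) \<le> card ((\<lambda>z. {B z, z}) ` ?U)"
    using fin by (intro card_mono bp_subset[OF assms(1)]) simp
  also have "\<dots> \<le> card ?U" by (rule card_image_le[OF fin])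
  finally show ?thesis using le by linarith
qed

lemma optimal:
  assumes "extends m" "\<And>z. z \<in> S \<Longrightarrow> closed m z"
  shows "card (bp E prefers (edges_of m)) = min_bp E prefers"
  unfolding min_bp_def
proof (rule Min_eqI[symmetric])
  have "finite {M. matching E M}"
    by (rule finite_subset[of _ "Pow E"]) (auto simp: matching_def finite_E)
  then show "finite {card (bp E prefers M) | M. matching E M}" by simp
  show "card (bp E prefers (edges_of m)) \<in> {card (bp E prefers M) | M. matching E M}"
    using matching_edges_of assms(1) by (auto simp: extends_def)
qed (use bp_le[OF assms] in auto)

end


section \<open>Running programs\<close>

abbreviation seq :: "com \<Rightarrow> com \<Rightarrow> com" (infixr ";;" 60) where
  "c ;; d \<equiv> Seq c d"

primrec loop_free :: "com \<Rightarrow> bool" where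
  "loop_free Skip \<longleftrightarrow> True"
| "loop_free (Assign x a) \<longleftrightarrow> True"
| "loop_free (Store x i a) \<longleftrightarrow> True"
| "loop_free (Seq c d) \<longleftrightarrow> loop_free c \<and> loop_free d"
| "loop_free (Cond b c d) \<longleftrightarrow> loop_free c \<and> loop_free d"
| "loop_free (While b c) \<longleftrightarrow> False"

text \<open>A functional account of loop-free code, so that simplification runs it symbolically;
  only loops require an argument about \<open>exec\<close>.\<close>

primrec outcome :: "com \<Rightarrow> state \<Rightarrow> state" where
  "outcome Skip s = s"
| "outcome (Assign x a) s = set_reg x (aval s a) s"
| "outcome (Store x i a) s = set_arr x (aval s i) (aval s a) s"
| "outcome (Seq c d) s = outcome d (outcome c s)"
| "outcome (Cond b c d) s = (if bval s b then outcome c s else outcome d s)"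
| "outcome (While b c) s = s"

primrec cfits :: "nat \<Rightarrow> state \<Rightarrow> com \<Rightarrow> bool" where
  "cfits w s Skip \<longleftrightarrow> True"
| "cfits w s (Assign x a) \<longleftrightarrow> afits w s a"
| "cfits w s (Store x i a) \<longleftrightarrow> afits w s i \<and> afits w s a"
| "cfits w s (Seq c d) \<longleftrightarrow> cfits w s c \<and> cfits w (outcome c s) d"
| "cfits w s (Cond b c d) \<longleftrightarrow> bfits w s b \<and> (if bval s b then cfits w s c else cfits w s d)"
| "cfits w s (While b c) \<longleftrightarrow> True"

text \<open>A conditional is charged for both branches. The bound thus depends on the program text
  only, not on the state.\<close>

primrec ccost :: "com \<Rightarrow> nat" where
  "ccost Skip = 1"
| "ccost (Assign x a) = acost a + 1"
| "ccost (Store x i a) = acost i + acost a + 1"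
| "ccost (Seq c d) = ccost c + ccost d"
| "ccost (Cond b c d) = bcost b + 1 + ccost c + ccost d"
| "ccost (While b c) = 0"

lemma exec_loop_free:
  "loop_free c \<Longrightarrow> cfits w s c \<Longrightarrow> \<exists>t\<le>ccost c. exec w c s t (outcome c s)"
proof (induction c arbitrary: s)
  case (Seq c d)
  then obtain t u where "t \<le> ccost c" "exec w c s t (outcome c s)"
    "u \<le> ccost d" "exec w d (outcome c s) u (outcome d (outcome c s))"
    by force
  then show ?case by (intro exI[of _ "t + u"]) (auto intro: exec_Seq)
next
  case (Cond b c d)
  show ?case
  proof (cases "bval s b")
    case True
    then obtain t where "t \<le> ccost c" "exec w c s t (outcome c s)" using Cond by force
    then show ?thesis using Cond.prems True
      by (intro exI[of _ "bcost b + 1 + t"]) (auto intro: exec_CondTrue[simplified])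
  next
    case False
    then obtain t where "t \<le> ccost d" "exec w d s t (outcome d s)" using Cond by force
    then show ?thesis using Cond.prems False
      by (intro exI[of _ "bcost b + 1 + t"]) (auto intro: exec_CondFalse[simplified])
  qed
qed (force intro: exec.intros exec_Skip[simplified] exec_Assign[simplified] exec_Store[simplified])+

text \<open>Each iteration lowers \<open>\<phi>\<close> by at least one and costs at most
  \<open>bcost b + 1 + ccost c\<close>; the last summand pays for the final, failing test.\<close>

lemma exec_while:
  fixes \<phi> :: "state \<Rightarrow> nat"
  assumes "loop_free c" "I s"
    and fits: "\<And>s. I s \<Longrightarrow> bfits w s b"
    and body: "\<And>s. I s \<Longrightarrow> bval s b \<Longrightarrow>
      cfits w s c \<and> I (outcome c s) \<and> \<phi> (outcome c s) < \<phi> s"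
  shows "\<exists>t s'. exec w (While b c) s t s' \<and> t \<le> (bcost b + 1 + ccost c) * \<phi> s + bcost b + 1 \<and>
    I s' \<and> \<not> bval s' b"
  using assms(2)
proof (induction "\<phi> s" arbitrary: s rule: less_induct)
  case less
  show ?case
  proof (cases "bval s b")
    case True
    let ?s = "outcome c s" and ?K = "bcost b + 1 + ccost c"
    have c: "cfits w s c" "I ?s" "\<phi> ?s < \<phi> s" using body[OF less.prems True] by auto
    obtain t where t: "t \<le> ccost c" "exec w c s t ?s"
      using exec_loop_free[OF assms(1) c(1)] by auto
    obtain u s' where u: "exec w (While b c) ?s u s'" "u \<le> ?K * \<phi> ?s + bcost b + 1"
      "I s'" "\<not> bval s' b"
      using less.hyps[OF c(3,2)] by blast
    have "exec w (While b c) s (bcost b + 1 + t + u) s'"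
      by (rule exec_WhileTrue[OF fits[OF less.prems] True t(2) u(1)])
    moreover have "?K * Suc (\<phi> ?s) \<le> ?K * \<phi> s" using c(3) by (intro mult_le_mono) auto
    then have "bcost b + 1 + t + u \<le> ?K * \<phi> s + bcost b + 1" using t(1) u(2) by simp
    ultimately show ?thesis using u by blast
  next
    case False
    then show ?thesis using exec_WhileFalse[OF fits[OF less.prems]] less.prems
      by (intro exI[of _ "bcost b + 1"] exI[of _ s]) auto
  qed
qed

lemma reg_set_reg [simp]: "reg (set_reg x v s) = (reg s)(x := v)"
  and arr_set_reg [simp]: "arr (set_reg x v s) = arr s"
  and reg_set_arr [simp]: "reg (set_arr a i v s) = reg s"
  and arr_set_arr [simp]: "arr (set_arr a i v s) = (arr s)(a := (arr s a)(i := v))"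
  by (simp_all add: set_reg_def set_arr_def)


section \<open>The program\<close>

text \<open>Index \<open>n\<close> becomes a placeholder agent with an empty list and the impossible
  mate \<open>n + 1\<close>. The stack pointer is already \<open>n\<close> because the reading loop
  puts every agent on the stack.\<close>

definition read_init :: com where
  "read_init =
     Assign ''i'' (Const 0);;
     Assign ''sp'' (Reg ''n'');;
     Store ''mate'' (Reg ''n'') (Plus (Reg ''n'') (Const 1));;
     Store ''fst'' (Reg ''n'') (Reg ''n'');;
     Store ''snd'' (Reg ''n'') (Reg ''n'');;
     Store ''tie'' (Reg ''n'') (Const 0)"

definition read_body :: com where
  "read_body =
     Store ''fst'' (Reg ''i'') (Reg ''n'');;
     Store ''snd'' (Reg ''i'') (Reg ''n'');;
     Store ''tie'' (Reg ''i'') (Const 0);;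
     Store ''mate'' (Reg ''i'') (Reg ''n'');;
     Store ''stack'' (Reg ''i'') (Reg ''i'');;
     Assign ''x'' (Arr ''start'' (Reg ''i''));;
     Assign ''y'' (Arr ''start'' (Plus (Reg ''i'') (Const 1)));;
     Cond (Less (Reg ''x'') (Reg ''y''))
       (Store ''fst'' (Reg ''i'') (Arr ''nbr'' (Reg ''x''))) Skip;;
     Assign ''x'' (Plus (Reg ''x'') (Const 1));;
     Cond (Less (Reg ''x'') (Reg ''y''))
       (Store ''snd'' (Reg ''i'') (Arr ''nbr'' (Reg ''x''));;
        Store ''tie'' (Reg ''i'') (Arr ''rank'' (Reg ''x''))) Skip;;
     Assign ''i'' (Plus (Reg ''i'') (Const 1))"

definition read_lists :: com where
  "read_lists = read_init;; While (Less (Reg ''i'') (Reg ''n'')) read_body"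

text \<open>The two disjunctions in \<open>best\<close> appear in De Morgan form.\<close>

definition best_test :: "string \<Rightarrow> string \<Rightarrow> bexp" where
  "best_test x y =
     BAnd (Eq (Arr ''mate'' (Reg y)) (Reg ''n''))
      (BNot (BAnd (BNot (Eq (Reg y) (Arr ''fst'' (Reg x))))
        (BNot (BAnd (Eq (Reg y) (Arr ''snd'' (Reg x)))
          (BNot (BAnd (Eq (Arr ''mate'' (Arr ''fst'' (Reg x))) (Reg ''n''))
            (BNot (Eq (Arr ''tie'' (Reg x)) (Const 0)))))))))"

definition mutual_test :: bexp where
  "mutual_test = BAnd (best_test ''x'' ''y'') (best_test ''y'' ''x'')"

definition push :: "aexp \<Rightarrow> com" where
  "push a = Store ''stack'' (Reg ''sp'') a;; Assign ''sp'' (Plus (Reg ''sp'') (Const 1))"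

text \<open>The second entry is taken whenever the first fails the test. It may fail as well, so
  \<open>greedy_body\<close> tests again.\<close>

definition pick :: com where
  "pick =
     Assign ''sp'' (Minus (Reg ''sp'') (Const 1));;
     Assign ''x'' (Arr ''stack'' (Reg ''sp''));;
     Assign ''y'' (Arr ''fst'' (Reg ''x''));;
     Cond mutual_test Skip (Assign ''y'' (Arr ''snd'' (Reg ''x'')))"

definition link_xy :: com where
  "link_xy =
     Store ''mate'' (Reg ''x'') (Reg ''y'');;
     Store ''mate'' (Reg ''y'') (Reg ''x'')"

text \<open>Missing and already matched entries are pushed too. They are popped later without
  effect, as they belong to no mutual pair.\<close>

definition push_nbrs :: com where
  "push_nbrs =
     push (Arr ''fst'' (Reg ''x''));; push (Arr ''snd'' (Reg ''x''));;
     push (Arr ''fst'' (Reg ''y''));; push (Arr ''snd'' (Reg ''y''))"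

definition greedy_body :: com where
  "greedy_body = pick;; Cond mutual_test (link_xy;; push_nbrs) Skip"

definition greedy :: com where
  "greedy = While (Less (Const 0) (Reg ''sp'')) greedy_body"

definition walk_init :: com where
  "walk_init = Assign ''a'' (Const 0);; Assign ''x'' (Const 0)"

definition walk_body :: com where
  "walk_body =
     Assign ''y'' (Arr ''fst'' (Reg ''x''));;
     Cond (BAnd (Eq (Arr ''mate'' (Reg ''x'')) (Reg ''n''))
         (Eq (Arr ''mate'' (Reg ''y'')) (Reg ''n'')))
       (link_xy;; Assign ''x'' (Arr ''fst'' (Reg ''y'')))
       (Assign ''a'' (Plus (Reg ''a'') (Const 1));; Assign ''x'' (Reg ''a''))"

definition cycles :: com where
  "cycles = walk_init;; While (Less (Reg ''a'') (Reg ''n'')) walk_body"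


section \<open>Correctness of the program\<close>

text \<open>\<open>4 * n + 10\<close> is a generous common bound: the stack pointer stays at most
  \<open>3 * n + 4\<close>, positions in the concatenated lists at most \<open>2 * n + 1\<close>,
  mates at most \<open>n + 1\<close>.\<close>

locale machine = short_lists n E prefers A B "\<lambda>x. D x = 0"
  for n :: nat and E prefers A B and D :: "nat \<Rightarrow> nat" +
  fixes w :: nat
  assumes word: "4 * n + 10 \<le> 2 ^ w"
    and D_le: "x \<le> n \<Longrightarrow> D x \<le> 2"
begin

lemma fits: "v \<le> 4 * n + 9 \<Longrightarrow> v < 2 ^ w"
  using word by linarith

text \<open>\<open>valid\<close> only asks for \<open>m n \<noteq> n\<close>; the exact value
  \<open>n + 1\<close> is recorded so that the mate of the placeholder fits into a word.\<close>

definition lists :: "state \<Rightarrow> bool" where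
  "lists s \<longleftrightarrow> reg s ''n'' = n \<and> arr s ''fst'' = A \<and> arr s ''snd'' = B \<and> arr s ''tie'' = D \<and>
     valid (arr s ''mate'') \<and> arr s ''mate'' n = n + 1"

lemma mate_le: "lists s \<Longrightarrow> x \<le> n \<Longrightarrow> arr s ''mate'' x \<le> n + 1"
  using valid_le[of "arr s ''mate''" x] by (cases "x = n") (auto simp: lists_def)

lemma bval_mutual_test:
  "lists s \<Longrightarrow> bval s mutual_test \<longleftrightarrow> mutual (arr s ''mate'') (reg s ''x'') (reg s ''y'')"
  by (auto simp: mutual_test_def best_test_def mutual_def best_def lists_def)

lemma bfits_mutual_test:
  assumes "lists s" "reg s ''x'' \<le> n" "reg s ''y'' \<le> n"
  shows "bfits w s mutual_test"
proof -
  have "arr s ''mate'' z < 2 ^ w" "A z < 2 ^ w" "B z < 2 ^ w" "D z < 2 ^ w" "z < 2 ^ w"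
    "arr s ''mate'' (A z) < 2 ^ w" if "z \<le> n" for z
    using mate_le[OF assms(1) that] mate_le[OF assms(1) A_le[OF that]]
      A_le[OF that] B_le[OF that] D_le[OF that] that
    by (auto intro!: fits)
  then show ?thesis
    using assms fits[of 0] by (simp add: mutual_test_def best_test_def lists_def)
qed

text \<open>The disjunction serves both loops: the greedy one links mutual pairs, the walk links an
  agent to its successor, which is not mutual.\<close>

lemma lists_link:
  assumes "lists s" "mutual (arr s ''mate'') (reg s ''x'') (reg s ''y'') \<or>
    arr s ''mate'' (reg s ''x'') = n \<and> arr s ''mate'' (reg s ''y'') = n \<and>
    {reg s ''x'', reg s ''y''} \<in> E" "reg s ''x'' \<le> n" "reg s ''y'' \<le> n"
  shows "lists (outcome link_xy s)"
    "arr (outcome link_xy s) ''mate'' = link (reg s ''x'') (reg s ''y'') (arr s ''mate'')"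
    "reg (outcome link_xy s) = reg s"
    "arr (outcome link_xy s) ''stack'' = arr s ''stack''"
    "cfits w s link_xy"
proof -
  have xy: "arr s ''mate'' (reg s ''x'') = n" "arr s ''mate'' (reg s ''y'') = n"
    "{reg s ''x'', reg s ''y''} \<in> E"
    using assms mutual_edge[of "arr s ''mate''" "reg s ''x''" "reg s ''y''"]
    by (auto simp: lists_def)
  show m: "arr (outcome link_xy s) ''mate'' = link (reg s ''x'') (reg s ''y'') (arr s ''mate'')"
    by (simp add: link_xy_def link_def)
  show "lists (outcome link_xy s)"
    using assms(1) valid_link[OF _ xy] edgeD[OF xy(3)] unfolding lists_def m
    by (auto simp: link_xy_def link_def)
  show "reg (outcome link_xy s) = reg s"
    "arr (outcome link_xy s) ''stack'' = arr s ''stack''"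
    by (simp_all add: link_xy_def)
  show "cfits w s link_xy"
    using assms(3,4) fits by (simp add: link_xy_def)
qed

section \<open>The greedy loop\<close>

definition pending :: "(nat \<Rightarrow> nat) \<Rightarrow> nat set \<Rightarrow> bool" where
  "pending m P \<longleftrightarrow> (\<forall>u\<le>n. \<forall>v\<le>n. mutual m u v \<longrightarrow> u \<in> P \<or> v \<in> P)"

text \<open>The bound \<open>3 * n\<close> on the potential also keeps the stack pointer within a
  word. Stack entries may equal the placeholder \<open>n\<close>.\<close>

definition greedy_inv :: "state \<Rightarrow> bool" where
  "greedy_inv s \<longleftrightarrow> lists s \<and> stable (arr s ''mate'') \<and>
     reg s ''sp'' + 2 * card (free (arr s ''mate'')) \<le> 3 * n \<and>
     (\<forall>i<reg s ''sp''. arr s ''stack'' i \<le> n) \<and>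
     pending (arr s ''mate'') (arr s ''stack'' ` {..<reg s ''sp''})"

lemma pick:
  assumes "lists s" "0 < reg s ''sp''" "reg s ''sp'' \<le> 3 * n"
    "arr s ''stack'' (reg s ''sp'' - 1) \<le> n"
  defines "x \<equiv> arr s ''stack'' (reg s ''sp'' - 1)"
  shows "cfits w s pick" "lists (outcome pick s)" "arr (outcome pick s) = arr s"
    "reg (outcome pick s) ''sp'' = reg s ''sp'' - 1" "reg (outcome pick s) ''x'' = x"
    "reg (outcome pick s) ''y'' = (if mutual (arr s ''mate'') x (A x) then A x else B x)"
proof -
  have x: "x \<le> n" using assms by simp
  define s1 where "s1 = set_reg ''y'' (A x) (set_reg ''x'' x (set_reg ''sp'' (reg s ''sp'' - 1) s))"
  have l: "lists s1" using assms(1) by (simp add: s1_def lists_def)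
  have o: "outcome pick s = (if mutual (arr s ''mate'') x (A x) then s1 else set_reg ''y'' (B x) s1)"
    using bval_mutual_test[OF l] assms(1)
    by (simp add: pick_def s1_def[symmetric] x_def[symmetric] lists_def)
      (simp add: s1_def x_def lists_def)
  show "lists (outcome pick s)" "arr (outcome pick s) = arr s"
    "reg (outcome pick s) ''sp'' = reg s ''sp'' - 1" "reg (outcome pick s) ''x'' = x"
    "reg (outcome pick s) ''y'' = (if mutual (arr s ''mate'') x (A x) then A x else B x)"
    using assms(1) by (auto simp: o s1_def lists_def)
  have "bfits w s1 mutual_test"
    by (rule bfits_mutual_test[OF l]) (use x A_le in \<open>auto simp: s1_def\<close>)
  moreover have "x < 2 ^ w" "A x < 2 ^ w" "B x < 2 ^ w" "reg s ''sp'' < 2 ^ w" "1 < (2::nat) ^ w"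
    "reg s ''sp'' - 1 < 2 ^ w"
    using x A_le[OF x] B_le[OF x] assms(3) by (auto intro!: fits)
  ultimately show "cfits w s pick"
    using assms(1) by (simp add: pick_def s1_def x_def lists_def)
qed

lemma push_nbrs:
  assumes "lists s" "reg s ''x'' \<le> n" "reg s ''y'' \<le> n" "reg s ''sp'' \<le> 3 * n"
  defines "p \<equiv> reg s ''sp''" and "x \<equiv> reg s ''x''" and "y \<equiv> reg s ''y''"
  shows "cfits w s push_nbrs" "lists (outcome push_nbrs s)"
    "arr (outcome push_nbrs s) ''mate'' = arr s ''mate''"
    "reg (outcome push_nbrs s) ''sp'' = p + 4"
    "arr (outcome push_nbrs s) ''stack'' = (arr s ''stack'')
       (p := A x, Suc p := B x, Suc (Suc p) := A y, Suc (Suc (Suc p)) := B y)"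
proof -
  have "A x < 2 ^ w" "B x < 2 ^ w" "x < 2 ^ w" "A y < 2 ^ w" "B y < 2 ^ w" "y < 2 ^ w"
    "1 < (2::nat) ^ w" "p < 2 ^ w" "Suc p < 2 ^ w" "Suc (Suc p) < 2 ^ w"
    "Suc (Suc (Suc p)) < 2 ^ w" "Suc (Suc (Suc (Suc p))) < 2 ^ w"
    using A_le[of x] B_le[of x] A_le[of y] B_le[of y] assms by (auto intro!: fits)
  then show "cfits w s push_nbrs"
    using assms(1) unfolding p_def x_def y_def by (simp add: push_nbrs_def push_def lists_def)
  show "lists (outcome push_nbrs s)"
    "arr (outcome push_nbrs s) ''mate'' = arr s ''mate''"
    "reg (outcome push_nbrs s) ''sp'' = p + 4"
    "arr (outcome push_nbrs s) ''stack'' = (arr s ''stack'')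
       (p := A x, Suc p := B x, Suc (Suc p) := A y, Suc (Suc (Suc p)) := B y)"
    using assms(1) by (simp_all add: push_nbrs_def push_def lists_def p_def x_def y_def)
qed

text \<open>The popped agent \<open>x\<close> may be dropped, since it is now matched and in no
  mutual pair. Pairs that have become mutual contain one of the four pushed neighbours.\<close>

lemma pending_link:
  assumes "valid m" "{x, y} \<in> E" "pending m (insert x P)" "{A x, B x, A y, B y} \<union> P \<subseteq> Q"
  shows "pending (link x y m) Q"
  unfolding pending_def
proof (intro allI impI)
  fix u v assume uv: "u \<le> n" "v \<le> n" "mutual (link x y m) u v"
  note * = mutual_link_imp[OF assms(1,2) uv(3,1,2)]
  show "u \<in> Q \<or> v \<in> Q"
  proof (cases "mutual m u v")
    case True
    then have "u \<in> insert x P \<or> v \<in> insert x P" using assms(3) uv by (auto simp: pending_def)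
    then show ?thesis using * assms(4) by blast
  next
    case False
    then show ?thesis using * assms(4) by blast
  qed
qed

lemma mutual_A_or_B: "mutual m x y \<Longrightarrow> y = A x \<or> y = B x"
  by (auto simp: mutual_def best_def)

lemma mutual_commute: "mutual m x y \<longleftrightarrow> mutual m y x"
  by (auto simp: mutual_def)

lemma greedy_body:
  assumes "greedy_inv s" "0 < reg s ''sp''"
  defines "\<phi> \<equiv> \<lambda>s. reg s ''sp'' + 2 * card (free (arr s ''mate''))"
  shows "cfits w s greedy_body \<and> greedy_inv (outcome greedy_body s) \<and>
    \<phi> (outcome greedy_body s) < \<phi> s"
proof -
  let ?m = "arr s ''mate''" and ?p = "reg s ''sp'' - 1"
  let ?x = "arr s ''stack'' ?p"
  have inv: "lists s" "stable ?m" "reg s ''sp'' + 2 * card (free ?m) \<le> 3 * n"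
    "\<And>i. i < reg s ''sp'' \<Longrightarrow> arr s ''stack'' i \<le> n"
    "pending ?m (arr s ''stack'' ` {..<reg s ''sp''})"
    using assms(1) by (auto simp: greedy_inv_def)
  have v: "valid ?m" using inv(1) by (simp add: lists_def)
  have x: "?x \<le> n" using inv(4) assms(2) by simp
  have "{..<reg s ''sp''} = insert ?p {..<?p}" using assms(2) by auto
  then have pend: "pending ?m (insert ?x (arr s ''stack'' ` {..<?p}))" using inv(5) by simp
  define s1 where "s1 = outcome pick s"
  have "reg s ''sp'' \<le> 3 * n" using inv(3) by simp
  note s1 = pick[OF inv(1) assms(2) this x, folded s1_def]
  define y where "y = reg s1 ''y''"
  have y: "y \<le> n" using s1(6) A_le[OF x] B_le[OF x] by (simp add: y_def)
  \<comment> \<open>A mutual partner of \<open>?x\<close> is one of its two list entries, so a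
    failing test for \<open>y\<close> shows that \<open>?x\<close> has none.\<close>
  have y_iff: "mutual ?m ?x y \<longleftrightarrow> (\<exists>z. mutual ?m ?x z)"
  proof
    assume "\<exists>z. mutual ?m ?x z"
    then obtain z where "mutual ?m ?x z" by blast
    then have "mutual ?m ?x (A ?x) \<or> mutual ?m ?x (B ?x)" using mutual_A_or_B by metis
    then show "mutual ?m ?x y" using s1(6) by (auto simp: y_def)
  qed blast
  have test: "bval s1 mutual_test \<longleftrightarrow> mutual ?m ?x y"
    using bval_mutual_test[OF s1(2)] s1 by (simp add: y_def)
  have ftest: "bfits w s1 mutual_test"
    by (rule bfits_mutual_test[OF s1(2)]) (use s1 x y in \<open>auto simp: y_def\<close>)
  show ?thesis
  proof (cases "mutual ?m ?x y")
    case False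
    have o: "outcome greedy_body s = s1" using False test by (simp add: greedy_body_def s1_def)
    \<comment> \<open>Hence \<open>?x\<close> witnesses no mutual pair, and popping it keeps
      \<open>pending\<close>.\<close>
    have nomut: "\<not> mutual ?m ?x z" "\<not> mutual ?m z ?x" for z
      using False y_iff mutual_commute by blast+
    have "pending ?m (arr s ''stack'' ` {..<?p})"
      unfolding pending_def
    proof (intro allI impI)
      fix u v assume uv: "u \<le> n" "v \<le> n" "mutual ?m u v"
      then have "u \<noteq> ?x" "v \<noteq> ?x" using nomut by blast+
      then show "u \<in> arr s ''stack'' ` {..<?p} \<or> v \<in> arr s ''stack'' ` {..<?p}"
        using pend uv unfolding pending_def by blast
    qed
    then have "greedy_inv s1" using inv s1 by (auto simp: greedy_inv_def)
    moreover have "\<phi> s1 < \<phi> s" using s1 assms(2) by (simp add: \<phi>_def)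
    moreover have "cfits w s greedy_body"
      using s1 ftest test False by (simp add: greedy_body_def s1_def[symmetric])
    ultimately show ?thesis using o by simp
  next
    case True
    define s2 where "s2 = outcome link_xy s1"
    define s3 where "s3 = outcome push_nbrs s2"
    have o: "outcome greedy_body s = s3" using True test
      by (simp add: greedy_body_def s1_def s2_def s3_def)
    have mut: "mutual (arr s1 ''mate'') (reg s1 ''x'') (reg s1 ''y'')"
      using True s1 by (simp add: y_def)
    have le: "reg s1 ''x'' \<le> n" "reg s1 ''y'' \<le> n" using s1 x y by (simp_all add: y_def)
    note s2 = lists_link[OF s1(2) disjI1[OF mut] le, folded s2_def]
    have regs: "reg s2 ''x'' = ?x" "reg s2 ''y'' = y" "reg s2 ''sp'' = ?p"
      using s2 s1 by (simp_all add: y_def)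
    have p: "reg s2 ''sp'' \<le> 3 * n" using regs inv(3) by simp
    note s3 = push_nbrs[OF s2(1), unfolded regs, OF x y p[unfolded regs], folded s3_def]
    have m3: "arr s3 ''mate'' = link ?x y ?m" using s3 s2 s1 by (simp add: y_def)
    note e = mutual_edge[OF v True x y]
    have card: "card (free (arr s3 ''mate'')) + 2 = card (free ?m)"
      unfolding m3 by (rule free_link[OF e])
    have sp: "reg s3 ''sp'' = ?p + 4" by (rule s3(4))
    have st: "arr s3 ''stack'' = (arr s ''stack'')(?p := A ?x, Suc ?p := B ?x,
        Suc (Suc ?p) := A y, Suc (Suc (Suc ?p)) := B y)"
      using s3(5) s2(4) s1(3) by simp
    have img: "{A ?x, B ?x, A y, B y} \<union> arr s ''stack'' ` {..<?p} = arr s3 ''stack'' ` {..<?p + 4}"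
    proof -
      have i: "{..<?p + 4} = {..<?p} \<union> {?p, Suc ?p, Suc (Suc ?p), Suc (Suc (Suc ?p))}" by auto
      have "arr s3 ''stack'' ` {..<?p} = arr s ''stack'' ` {..<?p}"
        unfolding st by (intro image_cong) auto
      moreover have "arr s3 ''stack'' ` {?p, Suc ?p, Suc (Suc ?p), Suc (Suc (Suc ?p))} =
          {A ?x, B ?x, A y, B y}"
        unfolding st by simp
      ultimately show ?thesis unfolding i image_Un by (simp only: Un_commute)
    qed
    have "pending (arr s3 ''mate'') (arr s3 ''stack'' ` {..<reg s3 ''sp''})"
      unfolding m3 sp by (rule pending_link[OF v e(3) pend]) (use img in simp)
    moreover have "arr s3 ''stack'' i \<le> n" if "i < reg s3 ''sp''" for i
    proof -
      have "arr s3 ''stack'' i \<in> {A ?x, B ?x, A y, B y} \<union> arr s ''stack'' ` {..<?p}"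
        unfolding img using that sp by simp
      then show ?thesis using A_le B_le x y inv(4) by auto
    qed
    moreover have "stable (arr s3 ''mate'')" unfolding m3 by (rule stable_link[OF v inv(2) True x y])
    ultimately have "greedy_inv s3"
      using s3(2) sp card inv(3) assms(2) by (auto simp: greedy_inv_def)
    moreover have "\<phi> s3 < \<phi> s" using sp card assms(2) by (simp add: \<phi>_def)
    moreover have "cfits w s greedy_body"
      using s1 ftest s2(5) s3(1)
      by (simp add: greedy_body_def s1_def[symmetric] s2_def[symmetric])
    ultimately show ?thesis using o by simp
  qed
qed

lemma greedy_final:
  assumes "greedy_inv s" "reg s ''sp'' = 0"
  shows "greedy_end n E prefers A B (\<lambda>x. D x = 0) (arr s ''mate'')"
  using assms by unfold_locales (auto simp: greedy_inv_def lists_def pending_def)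

lemma exec_greedy:
  assumes "greedy_inv s"
  shows "\<exists>t s'. exec w greedy s t s' \<and>
    t \<le> (bcost (Less (Const 0) (Reg ''sp'')) + 1 + ccost greedy_body) * (3 * n) +
      bcost (Less (Const 0) (Reg ''sp'')) + 1 \<and>
    lists s' \<and> greedy_end n E prefers A B (\<lambda>x. D x = 0) (arr s' ''mate'')"
proof -
  let ?\<phi> = "\<lambda>s. reg s ''sp'' + 2 * card (free (arr s ''mate''))"
  let ?b = "Less (Const 0) (Reg ''sp'')"
  have "\<exists>t s'. exec w greedy s t s' \<and> t \<le> (bcost ?b + 1 + ccost greedy_body) * ?\<phi> s + bcost ?b + 1 \<and>
      greedy_inv s' \<and> \<not> bval s' ?b"
    unfolding greedy_def
  proof (rule exec_while)
    show "loop_free greedy_body"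
      by (simp add: greedy_body_def pick_def link_xy_def push_nbrs_def push_def)
    show "bfits w s ?b" if "greedy_inv s" for s
      using that by (auto simp: greedy_inv_def intro!: fits)
    show "cfits w s greedy_body \<and> greedy_inv (outcome greedy_body s) \<and>
        ?\<phi> (outcome greedy_body s) < ?\<phi> s" if "greedy_inv s" "bval s ?b" for s
      using greedy_body[of s] that by simp
  qed (fact assms)
  then obtain t s' where s': "exec w greedy s t s'"
      "t \<le> (bcost ?b + 1 + ccost greedy_body) * ?\<phi> s + bcost ?b + 1"
      "greedy_inv s'" "reg s' ''sp'' = 0"
    by auto
  have "?\<phi> s \<le> 3 * n" using assms by (simp add: greedy_inv_def)
  then have "(bcost ?b + 1 + ccost greedy_body) * ?\<phi> s \<le> (bcost ?b + 1 + ccost greedy_body) * (3 * n)"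
    by (rule mult_le_mono2)
  then have "t \<le> (bcost ?b + 1 + ccost greedy_body) * (3 * n) + bcost ?b + 1" using s'(2) by linarith
  moreover have "lists s'" using s'(3) by (simp add: greedy_inv_def)
  ultimately show ?thesis using s'(1) greedy_final[OF s'(3,4)] by blast
qed

end

section \<open>The loop along the cycles\<close>

locale machine_end = machine + greedy_end n E prefers A B "\<lambda>x. D x = 0" m\<^sub>1 for m\<^sub>1
begin

definition cycles_inv :: "state \<Rightarrow> bool" where
  "cycles_inv s \<longleftrightarrow> lists s \<and> walk_inv (arr s ''mate'') (reg s ''a'') (reg s ''x'')"

text \<open>Every iteration either advances \<open>a\<close> or matches two agents. Both parts of
  \<open>\<phi>\<close> are at most \<open>n\<close>, which bounds the number of iterations by
  \<open>2 * n\<close> although cycles are met again at each of their agents.\<close>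

lemma walk_body:
  assumes "cycles_inv s" "reg s ''a'' < n"
  defines "\<phi> \<equiv> \<lambda>s. n - reg s ''a'' + card (free (arr s ''mate''))"
  shows "cfits w s walk_body \<and> cycles_inv (outcome walk_body s) \<and>
    \<phi> (outcome walk_body s) < \<phi> s"
proof -
  let ?m = "arr s ''mate''" and ?x = "reg s ''x''" and ?a = "reg s ''a''"
  have l: "lists s" and inv: "walk_inv ?m ?a ?x" using assms(1) by (auto simp: cycles_inv_def)
  have x: "?x \<le> n" and ext: "extends ?m" using inv by (auto simp: walk_inv_def)
  define s1 where "s1 = set_reg ''y'' (A ?x) s"
  have l1: "lists s1" using l by (simp add: s1_def lists_def)
  have y: "A ?x \<le> n" by (rule A_le[OF x])
  have nf: "?x < 2 ^ w" "A ?x < 2 ^ w" "n < 2 ^ w" "?m ?x < 2 ^ w" "?m (A ?x) < 2 ^ w"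
    "1 < (2::nat) ^ w" "?a < 2 ^ w" "Suc ?a < 2 ^ w"
    using x y mate_le[OF l x] mate_le[OF l y] assms(2) by (auto intro!: fits)
  have o1: "outcome (Assign ''y'' (Arr ''fst'' (Reg ''x''))) s = s1"
    using l by (simp add: s1_def lists_def)
  let ?b = "BAnd (Eq (Arr ''mate'' (Reg ''x'')) (Reg ''n'')) (Eq (Arr ''mate'' (Reg ''y'')) (Reg ''n''))"
  have b: "bval s1 ?b \<longleftrightarrow> ?m ?x = n \<and> ?m (A ?x) = n" "bfits w s1 ?b"
    using l nf by (simp_all add: s1_def lists_def)
  have f1: "cfits w s (Assign ''y'' (Arr ''fst'' (Reg ''x'')))"
    using l nf by (simp add: lists_def)
  show ?thesis
  proof (cases "?m ?x = n \<and> ?m (A ?x) = n")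
    case True
    define s2 where "s2 = outcome link_xy s1"
    have e: "{?x, A ?x} \<in> E" using extends_free_edge[OF ext x] True by simp
    have r: "reg s1 ''x'' = ?x" "reg s1 ''y'' = A ?x" "arr s1 = arr s" by (simp_all add: s1_def)
    have "arr s1 ''mate'' (reg s1 ''x'') = n \<and> arr s1 ''mate'' (reg s1 ''y'') = n \<and>
      {reg s1 ''x'', reg s1 ''y''} \<in> E" using True e r by simp
    note s2 = lists_link[OF l1 disjI2[OF this], unfolded r, OF x y, folded s2_def]
    have r2: "reg s2 ''y'' = A ?x" "reg s2 ''a'' = ?a" using s2(3) by (simp_all add: s1_def)
    let ?s3 = "set_reg ''x'' (A (A ?x)) s2"
    have o: "outcome walk_body s = ?s3"
      using True b s2(1) r2
      by (simp add: walk_body_def o1 s2_def[symmetric] lists_def del: bval.simps outcome.simps(2))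
        (simp add: lists_def)
    have "A (A ?x) < 2 ^ w" using A_le[OF y] by (auto intro!: fits)
    then have "cfits w s walk_body"
      using True b f1 s2(1,5) r2 nf
      by (simp add: walk_body_def o1 s2_def[symmetric] lists_def del: bval.simps bfits.simps outcome.simps(2))
    moreover have "cycles_inv ?s3"
      using s2(1,2) r2 walk_inv_link[OF inv] True by (simp add: cycles_inv_def lists_def)
    moreover have "card (free (arr ?s3 ''mate'')) + 2 = card (free ?m)"
      using s2(2) free_link[OF _ _ e] True by simp
    then have "\<phi> ?s3 < \<phi> s" using r2 by (simp add: \<phi>_def)
    ultimately show ?thesis using o by simp
  next
    case False
    let ?s2 = "set_reg ''x'' (Suc ?a) (set_reg ''a'' (Suc ?a) s1)"
    have o: "outcome walk_body s = ?s2"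
      using False l by (auto simp: walk_body_def s1_def lists_def)
    have "cfits w s walk_body"
      using False l nf by (auto simp: walk_body_def lists_def)
    moreover have "cycles_inv ?s2"
      using l1 walk_inv_next[OF inv False assms(2)] by (simp add: cycles_inv_def lists_def s1_def)
    moreover have "\<phi> ?s2 < \<phi> s" using assms(2) by (simp add: \<phi>_def s1_def)
    ultimately show ?thesis using o by simp
  qed
qed

lemma exec_cycles:
  assumes "lists s" "arr s ''mate'' = m\<^sub>1"
  shows "\<exists>t s' M. exec w cycles s t s' \<and>
    t \<le> ccost walk_init + ((bcost (Less (Reg ''a'') (Reg ''n'')) + 1 + ccost walk_body) * (2 * n) +
      bcost (Less (Reg ''a'') (Reg ''n'')) + 1) \<and>
    matching E M \<and> encodes_matching n M s' \<and> card (bp E prefers M) = min_bp E prefers"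
proof -
  let ?\<phi> = "\<lambda>s. n - reg s ''a'' + card (free (arr s ''mate''))"
  let ?b = "Less (Reg ''a'') (Reg ''n'')"
  let ?K = "bcost ?b + 1 + ccost walk_body"
  let ?s = "outcome walk_init s"
  have "cfits w s walk_init" using fits[of 0] by (simp add: walk_init_def)
  then obtain t where t: "t \<le> ccost walk_init" "exec w walk_init s t ?s"
    using exec_loop_free[of walk_init] by (auto simp: walk_init_def)
  have inv: "cycles_inv ?s"
    using assms walk_inv_init by (simp add: cycles_inv_def walk_init_def lists_def)
  have "\<exists>t s'. exec w (While ?b walk_body) ?s t s' \<and> t \<le> ?K * ?\<phi> ?s + bcost ?b + 1 \<and>
      cycles_inv s' \<and> \<not> bval s' ?b"
  proof (rule exec_while)
    show "loop_free walk_body" by (simp add: walk_body_def link_xy_def)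
    show "bfits w s ?b" if "cycles_inv s" for s
      using that by (auto simp: cycles_inv_def walk_inv_def lists_def intro!: fits)
    show "cfits w s walk_body \<and> cycles_inv (outcome walk_body s) \<and>
        ?\<phi> (outcome walk_body s) < ?\<phi> s" if "cycles_inv s" "bval s ?b" for s
      using walk_body[of s] that by (simp add: cycles_inv_def lists_def)
  qed (fact inv)
  then obtain u s' where u: "exec w (While ?b walk_body) ?s u s'"
      "u \<le> ?K * ?\<phi> ?s + bcost ?b + 1" "cycles_inv s'" "\<not> bval s' ?b"
    by blast
  have "reg s' ''a'' = n" using u(3,4) by (auto simp: cycles_inv_def walk_inv_def lists_def)
  then have wi: "walk_inv (arr s' ''mate'') n (reg s' ''x'')"
    using u(3) by (simp add: cycles_inv_def)
  note fin = walk_inv_end[OF wi]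
  have v: "valid (arr s' ''mate'')" using fin(1) by (simp add: extends_def)
  have "?\<phi> ?s \<le> 2 * n" using card_free_le[of m\<^sub>1] assms by (simp add: walk_init_def)
  then have "?K * ?\<phi> ?s \<le> ?K * (2 * n)" by (rule mult_le_mono2)
  then have "t + u \<le> ccost walk_init + (?K * (2 * n) + bcost ?b + 1)" using t(1) u(2) by linarith
  moreover have "exec w cycles s (t + u) s'"
    unfolding cycles_def by (rule exec_Seq[OF t(2) u(1)])
  ultimately show ?thesis
    using matching_edges_of[OF v] encodes_edges_of[OF v refl] optimal[OF fin] by blast
qed

end


section \<open>Reading the preference lists\<close>

locale instance_lists = srti "{..<n}" E prefers
  for n :: nat and E :: "nat set set" and prefers :: "nat \<Rightarrow> nat \<Rightarrow> nat \<Rightarrow> bool" +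
  fixes L :: "nat \<Rightarrow> nat list"
  assumes pref_list: "a < n \<Longrightarrow> preference_list E prefers a (L a)"
    and length_le: "a < n \<Longrightarrow> length (L a) \<le> 2"
begin

definition entry :: "nat \<Rightarrow> nat \<Rightarrow> nat" where
  "entry k a = (if a < n \<and> k < length (L a) then L a ! k else n)"

text \<open>In a sorted list of length two only the first entry can be strictly preferred to the
  second. So the rank of the second entry is \<open>0\<close> exactly for a tie.\<close>

definition tie_rank :: "nat \<Rightarrow> nat" where
  "tie_rank a =
     (if a < n \<and> 1 < length (L a) then card {b \<in> nbrs E a. prefers a b (L a ! 1)} else 0)"

lemma set_L: "a < n \<Longrightarrow> set (L a) = nbrs E a"
  using pref_list by (auto simp: preference_list_def)

lemma nbrs_lt: "b \<in> nbrs E a \<Longrightarrow> b < n"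
  using edges by (fastforce simp: nbrs_def doubleton_eq_iff)

lemma entry_le: "entry k a \<le> n"
proof (cases "a < n \<and> k < length (L a)")
  case True
  then have "L a ! k \<in> nbrs E a" using set_L nth_mem by blast
  then show ?thesis using True nbrs_lt by (simp add: entry_def less_imp_le_nat)
qed (auto simp: entry_def)

lemma tie_rank_le: "tie_rank a \<le> 2"
proof (cases "a < n")
  case True
  then have "card (nbrs E a) \<le> 2"
    using length_le[OF True] card_length[of "L a"] by (simp add: set_L[OF True])
  moreover have "card {b \<in> nbrs E a. prefers a b (L a ! 1)} \<le> card (nbrs E a)"
    by (intro card_mono) (auto simp: set_L[OF True, symmetric])
  ultimately show ?thesis by (simp add: tie_rank_def)
qed (simp add: tie_rank_def)

text \<open>Agreement is required up to \<open>n\<close> only, because the arrays hold arbitrary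
  values beyond.\<close>

lemma short_listsI:
  assumes "\<And>a. a \<le> n \<Longrightarrow> A a = entry 0 a" "\<And>a. a \<le> n \<Longrightarrow> B a = entry 1 a"
    "\<And>a. a \<le> n \<Longrightarrow> D a = tie_rank a"
  shows "short_lists n E prefers A B (\<lambda>x. D x = 0)"
proof (unfold_locales)
  show "A n = n" "B n = n" using assms by (simp_all add: entry_def)
  fix x assume x: "x < n"
  have A: "A x = entry 0 x" and B: "B x = entry 1 x" and D: "D x = tie_rank x"
    using assms x by simp_all
  have n: "n \<notin> nbrs E x" using nbrs_lt by blast
  have irr: "\<not> prefers x c c" if "c \<in> nbrs E x" for c
    using pref_irrefl[of x] x that by (auto simp: irreflp_on_def)
  have pl: "distinct (L x)" "sorted_wrt (\<lambda>b c. \<not> prefers x c b) (L x)"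
    using pref_list[OF x] by (auto simp: preference_list_def)
  consider "L x = []" | b where "L x = [b]" | b c where "L x = [b, c]"
    using length_le[OF x] by (cases "L x"; cases "tl (L x)") (auto simp: le_Suc_eq)
  then have "nbrs E x = {A x, B x} - {n} \<and> (A x = B x \<longrightarrow> A x = n) \<and>
      (A x \<noteq> n \<longrightarrow> B x \<noteq> n \<longrightarrow> \<not> prefers x (B x) (A x) \<and> (D x = 0 \<longleftrightarrow> \<not> prefers x (A x) (B x)))"
  proof cases
    case 1
    then show ?thesis using set_L[OF x] by (simp add: A B entry_def)
  next
    case (2 b)
    then show ?thesis using set_L[OF x] n by (auto simp: A B entry_def x)
  next
    case (3 b c)
    then have bc: "A x = b" "B x = c" "nbrs E x = {b, c}" "b \<noteq> c" "\<not> prefers x c b"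
      using set_L[OF x] pl by (simp_all add: A B entry_def x)
    have "{z \<in> nbrs E x. prefers x z c} = (if prefers x b c then {b} else {})"
      using bc irr by auto
    then have "D x = (if prefers x b c then 1 else 0)"
      using 3 x by (simp add: D tie_rank_def)
    then show ?thesis using bc n by auto
  qed
  then show "nbrs E x = {A x, B x} - {n}"
    "A x = B x \<Longrightarrow> A x = n"
    "A x \<noteq> n \<Longrightarrow> B x \<noteq> n \<Longrightarrow> \<not> prefers x (B x) (A x)"
    "A x \<noteq> n \<Longrightarrow> B x \<noteq> n \<Longrightarrow> (D x = 0) = (\<not> prefers x (A x) (B x))"
    by blast+
qed

end

section \<open>The reading loop\<close>

locale reading = instance_lists +
  fixes w :: nat and s\<^sub>0 :: state
  assumes word: "4 * n + 10 \<le> 2 ^ w"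
    and n_reg: "reg s\<^sub>0 ''n'' = n"
    and start: "a \<le> n \<Longrightarrow> arr s\<^sub>0 ''start'' a = (\<Sum>b<a. length (L b))"
    and stored: "a < n \<Longrightarrow> i < length (L a) \<Longrightarrow>
      arr s\<^sub>0 ''nbr'' (arr s\<^sub>0 ''start'' a + i) = L a ! i \<and>
      arr s\<^sub>0 ''rank'' (arr s\<^sub>0 ''start'' a + i) = card {b \<in> nbrs E a. prefers a b (L a ! i)}"
begin

lemma fits: "v \<le> 4 * n + 9 \<Longrightarrow> v < 2 ^ w"
  using word by linarith

lemma start_Suc: "a < n \<Longrightarrow> arr s\<^sub>0 ''start'' (Suc a) = arr s\<^sub>0 ''start'' a + length (L a)"
  using start[of a] start[of "Suc a"] by simp

lemma start_le: assumes "a \<le> n" shows "arr s\<^sub>0 ''start'' a \<le> 2 * n"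
proof -
  have "(\<Sum>b<a. length (L b)) \<le> of_nat (card {..<a}) * 2"
    using length_le assms by (intro sum_bounded_above) auto
  then show ?thesis using start[OF assms] assms by simp
qed

definition read_inv :: "state \<Rightarrow> bool" where
  "read_inv s \<longleftrightarrow> reg s ''n'' = n \<and> reg s ''i'' \<le> n \<and> reg s ''sp'' = n \<and>
     arr s ''start'' = arr s\<^sub>0 ''start'' \<and> arr s ''nbr'' = arr s\<^sub>0 ''nbr'' \<and>
     arr s ''rank'' = arr s\<^sub>0 ''rank'' \<and> arr s ''mate'' n = n + 1 \<and>
     (\<forall>a. a < reg s ''i'' \<or> a = n \<longrightarrow> arr s ''fst'' a = entry 0 a \<and>
        arr s ''snd'' a = entry 1 a \<and> arr s ''tie'' a = tie_rank a) \<and>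
     (\<forall>a < reg s ''i''. arr s ''mate'' a = n \<and> arr s ''stack'' a = a)"

lemma read_init: "cfits w s\<^sub>0 read_init" "read_inv (outcome read_init s\<^sub>0)"
    "reg (outcome read_init s\<^sub>0) ''i'' = 0"
  by (auto simp: read_init_def n_reg read_inv_def entry_def tie_rank_def intro!: fits)

lemma read_body:
  assumes "read_inv s" "reg s ''i'' < n"
  shows "cfits w s read_body \<and> read_inv (outcome read_body s) \<and>
    n - reg (outcome read_body s) ''i'' < n - reg s ''i''"
proof -
  let ?i = "reg s ''i''"
  let ?p = "arr s\<^sub>0 ''start'' ?i" and ?l = "length (L ?i)"
  have i: "?i < n" "?i \<noteq> n" using assms(2) by simp_all
  have l: "?l \<le> 2" by (rule length_le[OF i(1)])
  have s: "reg s ''n'' = n" "reg s ''sp'' = n" "arr s ''start'' = arr s\<^sub>0 ''start''"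
    "arr s ''nbr'' = arr s\<^sub>0 ''nbr''" "arr s ''rank'' = arr s\<^sub>0 ''rank''"
    and mate: "arr s ''mate'' n = n + 1"
    and done1: "\<And>a. a < ?i \<or> a = n \<Longrightarrow> arr s ''fst'' a = entry 0 a \<and>
        arr s ''snd'' a = entry 1 a \<and> arr s ''tie'' a = tie_rank a"
    and done2: "\<And>a. a < ?i \<Longrightarrow> arr s ''mate'' a = n \<and> arr s ''stack'' a = a"
    using assms(1) by (auto simp: read_inv_def)
  have nbr: "k < ?l \<Longrightarrow> arr s\<^sub>0 ''nbr'' (?p + k) = entry k ?i" for k
    using stored[OF i(1)] i by (simp add: entry_def)
  have tie: "1 < ?l \<Longrightarrow> arr s\<^sub>0 ''rank'' (?p + 1) = tie_rank ?i"
    using stored[OF i(1), of 1] i by (simp add: tie_rank_def)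
  \<comment> \<open>For lists shorter than two, the defaults stored at the beginning of the body
    remain in place.\<close>
  have ent: "\<not> k < ?l \<Longrightarrow> entry k ?i = n" for k by (simp add: entry_def)
  have tie0: "\<not> 1 < ?l \<Longrightarrow> tie_rank ?i = 0" by (simp add: tie_rank_def)
  note S = start_Suc[OF i(1)]
  have regs: "reg (outcome read_body s) ''n'' = n" "reg (outcome read_body s) ''sp'' = n"
    "reg (outcome read_body s) ''i'' = Suc ?i"
    and arrs: "arr (outcome read_body s) ''start'' = arr s\<^sub>0 ''start''"
    "arr (outcome read_body s) ''nbr'' = arr s\<^sub>0 ''nbr''"
    "arr (outcome read_body s) ''rank'' = arr s\<^sub>0 ''rank''"
    "arr (outcome read_body s) ''mate'' = (arr s ''mate'')(?i := n)"
    "arr (outcome read_body s) ''stack'' = (arr s ''stack'')(?i := ?i)"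
    "arr (outcome read_body s) ''fst'' = (arr s ''fst'')(?i := entry 0 ?i)"
    "arr (outcome read_body s) ''snd'' = (arr s ''snd'')(?i := entry 1 ?i)"
    "arr (outcome read_body s) ''tie'' = (arr s ''tie'')(?i := tie_rank ?i)"
    using s S nbr[of 0] nbr[of 1] tie ent[of 0] ent[of 1] tie0
    by (simp_all add: read_body_def fun_eq_iff)
  have "read_inv (outcome read_body s)"
    unfolding read_inv_def regs arrs using mate done1 done2 i by (auto simp: less_Suc_eq)
  moreover have "?i < 2 ^ w" "n < 2 ^ w" "Suc ?i < 2 ^ w" "?p < 2 ^ w" "Suc ?p < 2 ^ w"
    "1 < (2::nat) ^ w" "0 < (2::nat) ^ w" "arr s\<^sub>0 ''start'' (Suc ?i) < 2 ^ w"
    "?p + ?l < 2 ^ w"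
    "entry 0 ?i < 2 ^ w" "entry 1 ?i < 2 ^ w" "tie_rank ?i < 2 ^ w"
    using i start_le[of ?i] start_le[of "Suc ?i"] l entry_le[of 0 ?i] entry_le[of 1 ?i] tie_rank_le[of ?i]
    by (auto intro!: fits)
  then have "cfits w s read_body"
    using s S nbr[of 0] nbr[of 1] tie by (simp add: read_body_def)
  ultimately show ?thesis using regs i by simp
qed

lemma exec_read_lists:
  "\<exists>t s. exec w read_lists s\<^sub>0 t s \<and>
    t \<le> ccost read_init + ((bcost (Less (Reg ''i'') (Reg ''n'')) + 1 + ccost read_body) * n +
      bcost (Less (Reg ''i'') (Reg ''n'')) + 1) \<and> read_inv s \<and> reg s ''i'' = n"
proof -
  let ?b = "Less (Reg ''i'') (Reg ''n'')"
  let ?K = "bcost ?b + 1 + ccost read_body"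
  let ?s = "outcome read_init s\<^sub>0"
  obtain t where t: "t \<le> ccost read_init" "exec w read_init s\<^sub>0 t ?s"
    using exec_loop_free[OF _ read_init(1)] by (auto simp: read_init_def)
  have "\<exists>t s'. exec w (While ?b read_body) ?s t s' \<and>
      t \<le> ?K * (n - reg ?s ''i'') + bcost ?b + 1 \<and> read_inv s' \<and> \<not> bval s' ?b"
  proof (rule exec_while)
    show "loop_free read_body" by (simp add: read_body_def)
    show "bfits w s ?b" if "read_inv s" for s
      using that by (auto simp: read_inv_def intro!: fits)
    show "cfits w s read_body \<and> read_inv (outcome read_body s) \<and>
        n - reg (outcome read_body s) ''i'' < n - reg s ''i''" if "read_inv s" "bval s ?b" for s
      using read_body[of s] that by (simp add: read_inv_def)
  qed (fact read_init)
  then obtain u s where u: "exec w (While ?b read_body) ?s u s"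
      "u \<le> ?K * n + bcost ?b + 1" "read_inv s" "\<not> bval s ?b"
    using read_init(3) by auto
  then have "exec w read_lists s\<^sub>0 (t + u) s" unfolding read_lists_def using exec_Seq[OF t(2) u(1)] by simp
  moreover have "t + u \<le> ccost read_init + (?K * n + bcost ?b + 1)" using t(1) u(2) by linarith
  moreover have "reg s ''i'' = n" using u(3,4) by (auto simp: read_inv_def)
  ultimately show ?thesis using u(3) by blast
qed

text \<open>Nobody is matched yet, so \<open>stable\<close> holds vacuously, and
  \<open>pending\<close> holds because every agent is on the stack.\<close>

lemma read_final:
  assumes "read_inv s" "reg s ''i'' = n"
  shows "machine n E prefers (arr s ''fst'') (arr s ''snd'') (arr s ''tie'') w"
    "machine.greedy_inv n E prefers (arr s ''fst'') (arr s ''snd'') (arr s ''tie'') s"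
proof -
  let ?A = "arr s ''fst''" and ?B = "arr s ''snd''" and ?D = "arr s ''tie''"
  have lists: "?A a = entry 0 a" "?B a = entry 1 a" "?D a = tie_rank a" if "a \<le> n" for a
    using assms that by (auto simp: read_inv_def le_less)
  have "short_lists n E prefers ?A ?B (\<lambda>x. ?D x = 0)"
    by (rule short_listsI) (use lists in auto)
  then interpret short_lists n E prefers ?A ?B "\<lambda>x. ?D x = 0" .
  show m: "machine n E prefers ?A ?B ?D w"
    by unfold_locales (use word lists tie_rank_le in auto)
  interpret machine n E prefers ?A ?B ?D w by (fact m)
  have mate: "arr s ''mate'' a = n" "arr s ''stack'' a = a" if "a < n" for a
    using assms that by (auto simp: read_inv_def)
  have s: "reg s ''n'' = n" "arr s ''mate'' n = n + 1" "reg s ''sp'' = n"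
    using assms by (auto simp: read_inv_def)
  have "valid (arr s ''mate'')" using mate s by (auto simp: valid_def)
  moreover have "stable (arr s ''mate'')"
    using mate edgeD unfolding stable_def by blast
  moreover have "pending (arr s ''mate'') (arr s ''stack'' ` {..<n})"
    unfolding pending_def
  proof (intro allI impI disjI1)
    fix u v assume "u \<le> n" "mutual (arr s ''mate'') u v"
    then have "u < n" using s(2) by (cases "u = n") (auto simp: mutual_def best_def)
    then show "u \<in> arr s ''stack'' ` {..<n}"
      using mate(2)[of u] by (intro image_eqI[of _ _ u]) auto
  qed
  ultimately show "greedy_inv s"
    using s mate(2) card_free_le[of "arr s ''mate''"]
    by (auto simp: greedy_inv_def lists_def)
qed

end


section \<open>Running time\<close>

definition program :: com where
  "program = read_lists;; greedy;; cycles"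

lemma exec_program:
  "\<exists>a b. \<forall>n E prefers s w. srti {..<n} E prefers \<longrightarrow>
     (\<forall>a<n. \<forall>xs. preference_list E prefers a xs \<longrightarrow> length xs \<le> 2) \<longrightarrow>
     encodes_instance n E prefers s \<longrightarrow> 4 * n + 10 \<le> 2 ^ w \<longrightarrow>
     (\<exists>t s' M. exec w program s t s' \<and> t \<le> a * n + b \<and>
        matching E M \<and> encodes_matching n M s' \<and> card (bp E prefers M) = min_bp E prefers)"
proof -
  let ?b\<^sub>1 = "Less (Reg ''i'') (Reg ''n'')" and ?b\<^sub>2 = "Less (Const 0) (Reg ''sp'')"
    and ?b\<^sub>3 = "Less (Reg ''a'') (Reg ''n'')"
  define k\<^sub>1 where "k\<^sub>1 = bcost ?b\<^sub>1 + 1 + ccost read_body"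
  define k\<^sub>2 where "k\<^sub>2 = bcost ?b\<^sub>2 + 1 + ccost greedy_body"
  define k\<^sub>3 where "k\<^sub>3 = bcost ?b\<^sub>3 + 1 + ccost walk_body"
  define c\<^sub>1 where "c\<^sub>1 = ccost read_init + bcost ?b\<^sub>1 + 1"
  define c\<^sub>2 where "c\<^sub>2 = bcost ?b\<^sub>2 + 1"
  define c\<^sub>3 where "c\<^sub>3 = ccost walk_init + bcost ?b\<^sub>3 + 1"
  \<comment> \<open>The factors 1, 3 and 2 stem from at most \<open>n\<close>, \<open>3 * n\<close>
    and \<open>2 * n\<close> iterations of the three loops. All constants depend on the program text
    only.\<close>
  have "\<exists>t s' M. exec w program s t s' \<and>
      t \<le> (k\<^sub>1 + 3 * k\<^sub>2 + 2 * k\<^sub>3) * n + (c\<^sub>1 + c\<^sub>2 + c\<^sub>3) \<and>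
      matching E M \<and> encodes_matching n M s' \<and> card (bp E prefers M) = min_bp E prefers"
    if prems: "srti {..<n} E prefers" "\<forall>a<n. \<forall>xs. preference_list E prefers a xs \<longrightarrow> length xs \<le> 2"
      "encodes_instance n E prefers s" "4 * n + 10 \<le> 2 ^ w" for n E prefers s w
  proof -
    obtain L where L: "\<forall>a<n. preference_list E prefers a (L a)"
      "\<forall>a\<le>n. arr s ''start'' a = (\<Sum>b<a. length (L b))"
      "\<forall>a<n. \<forall>i<length (L a). arr s ''nbr'' (arr s ''start'' a + i) = L a ! i \<and>
         arr s ''rank'' (arr s ''start'' a + i) = card {b \<in> nbrs E a. prefers a b (L a ! i)}"
      "reg s ''n'' = n"
      using prems(3) unfolding encodes_instance_def by blast
    have "instance_lists n E prefers L"
      by (intro instance_lists.intro instance_lists_axioms.intro) (use prems L in auto)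
    then interpret R: reading n E prefers L w s
      by (intro reading.intro reading_axioms.intro) (use prems L in auto)
    obtain t\<^sub>1 s\<^sub>1 where 1: "exec w read_lists s t\<^sub>1 s\<^sub>1" "t\<^sub>1 \<le> k\<^sub>1 * n + c\<^sub>1"
      "R.read_inv s\<^sub>1" "reg s\<^sub>1 ''i'' = n"
      using R.exec_read_lists unfolding k\<^sub>1_def c\<^sub>1_def by (auto simp: algebra_simps)
    let ?A = "arr s\<^sub>1 ''fst''" and ?B = "arr s\<^sub>1 ''snd''" and ?D = "arr s\<^sub>1 ''tie''"
    interpret M: machine n E prefers ?A ?B ?D w by (rule R.read_final[OF 1(3,4)])
    obtain t\<^sub>2 s\<^sub>2 where 2: "exec w greedy s\<^sub>1 t\<^sub>2 s\<^sub>2" "t\<^sub>2 \<le> k\<^sub>2 * (3 * n) + c\<^sub>2" "M.lists s\<^sub>2"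
      "greedy_end n E prefers ?A ?B (\<lambda>x. ?D x = 0) (arr s\<^sub>2 ''mate'')"
      using M.exec_greedy[OF R.read_final(2)[OF 1(3,4)]] unfolding k\<^sub>2_def c\<^sub>2_def add.assoc by blast
    interpret C: machine_end n E prefers ?A ?B ?D w "arr s\<^sub>2 ''mate''"
      by (intro machine_end.intro M.machine_axioms 2(4))
    obtain t\<^sub>3 s\<^sub>3 M where 3: "exec w cycles s\<^sub>2 t\<^sub>3 s\<^sub>3" "t\<^sub>3 \<le> k\<^sub>3 * (2 * n) + c\<^sub>3"
      "matching E M" "encodes_matching n M s\<^sub>3" "card (bp E prefers M) = min_bp E prefers"
      using C.exec_cycles[OF 2(3) refl] unfolding k\<^sub>3_def c\<^sub>3_def by (auto simp: algebra_simps)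
    have "exec w program s (t\<^sub>1 + (t\<^sub>2 + t\<^sub>3)) s\<^sub>3"
      unfolding program_def by (rule exec_Seq[OF 1(1) exec_Seq[OF 2(1) 3(1)]])
    moreover have "t\<^sub>1 + (t\<^sub>2 + t\<^sub>3) \<le> (k\<^sub>1 + 3 * k\<^sub>2 + 2 * k\<^sub>3) * n + (c\<^sub>1 + c\<^sub>2 + c\<^sub>3)"
      using 1(2) 2(2) 3(2) by (simp add: algebra_simps)
    ultimately show ?thesis using 3 by blast
  qed
  then show ?thesis by blast
qed

lemma affine_bigo: "(\<lambda>n. real (a * n + b)) \<in> O(\<lambda>n. real n)"
proof (rule bigoI[where c = "real (a + b)"])
  show "\<forall>\<^sub>F n in sequentially. norm (real (a * n + b)) \<le> real (a + b) * norm (real n)"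
  proof (rule eventually_mono[OF eventually_ge_at_top[of 1]])
    fix n :: nat assume "1 \<le> n"
    then have "a * n + b \<le> (a + b) * n" by (simp add: algebra_simps)
    then show "norm (real (a * n + b)) \<le> real (a + b) * norm (real n)"
      by (simp del: of_nat_add of_nat_mult add: of_nat_mult[symmetric])
  qed
qed

section \<open>Words of logarithmic length\<close>

definition word_length :: "nat \<Rightarrow> nat" where
  "word_length n = nat \<lceil>log 2 (real (4 * n + 10))\<rceil>"

lemma word_length: "4 * n + 10 \<le> 2 ^ word_length n"
proof -
  have "real (4 * n + 10) = 2 powr log 2 (real (4 * n + 10))" by (simp del: of_nat_add)
  also have "\<dots> \<le> 2 powr real (word_length n)"
    unfolding word_length_def by (intro powr_mono real_nat_ceiling_ge) auto
  also have "\<dots> = real (2 ^ word_length n)" by (simp add: powr_realpow)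
  finally show ?thesis by (simp only: of_nat_le_iff)
qed

lemma word_length_bigo: "(\<lambda>n. real (word_length n)) \<in> O(\<lambda>n. ln (real n))"
proof (rule bigoI[where c = "3 / ln 2 + 1"])
  show "\<forall>\<^sub>F n in sequentially. norm (real (word_length n)) \<le> (3 / ln 2 + 1) * norm (ln (real n))"
  proof (rule eventually_mono[OF eventually_ge_at_top[of 3]])
    fix n :: nat assume n: "3 \<le> n"
    \<comment> \<open>From \<open>n = 3\<close> on,
      \<open>4 * n + 10 \<le> 9 * n \<le> n ^ 3\<close>, which gives the factor 3 in the
      logarithm.\<close>
    have "3 * 3 * n \<le> n * n * n" using n by (intro mult_le_mono) auto
    moreover have "n * n * n = n ^ 3" by (simp add: power3_eq_cube)
    ultimately have "4 * n + 10 \<le> n ^ 3" using n by linarith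
    then have "real (4 * n + 10) \<le> real n ^ 3" by (simp flip: of_nat_power)
    then have "log 2 (real (4 * n + 10)) \<le> log 2 (real n ^ 3)" by (intro log_mono) auto
    also have "\<dots> = 3 / ln 2 * ln (real n)" using n by (simp add: log_def ln_realpow)
    finally have 1: "log 2 (real (4 * n + 10)) \<le> 3 / ln 2 * ln (real n)" .
    \<comment> \<open>Then \<open>ln (real n)\<close> is at least 1 and absorbs the unit added by
      rounding up.\<close>
    have "exp 1 \<le> real n" using exp_le n by linarith
    then have 2: "1 \<le> ln (real n)" using n by (simp add: ln_ge_iff)
    have "0 \<le> log 2 (real (4 * n + 10))" by simp
    then have "real (word_length n) \<le> log 2 (real (4 * n + 10)) + 1"
      unfolding word_length_def by linarith
    then show "norm (real (word_length n)) \<le> (3 / ln 2 + 1) * norm (ln (real n))"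
      using 1 2 by (simp add: algebra_simps)
  qed
qed

theorem theorem7:
  "\<exists>(prog :: com) (T :: nat \<Rightarrow> nat) (wordlen :: nat \<Rightarrow> nat).
     (\<lambda>n. real (T n)) \<in> O(\<lambda>n. real n) \<and>
     (\<lambda>n. real (wordlen n)) \<in> O(\<lambda>n. ln (real n)) \<and>
     (\<forall>(n :: nat) (E :: nat set set) (prefers :: nat \<Rightarrow> nat \<Rightarrow> nat \<Rightarrow> bool) (s :: state).
        srti {..<n} E prefers \<longrightarrow>
        (\<forall>a<n. \<forall>xs. preference_list E prefers a xs \<longrightarrow> length xs \<le> 2) \<longrightarrow>
        encodes_instance n E prefers s \<longrightarrow>
        (\<exists>t s' M. exec (wordlen n) prog s t s' \<and> t \<le> T n \<and>
           matching E M \<and> encodes_matching n M s' \<and>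
           card (bp E prefers M) = min_bp E prefers))"
proof -
  obtain a b where "\<forall>n E prefers s w. srti {..<n} E prefers \<longrightarrow>
     (\<forall>a<n. \<forall>xs. preference_list E prefers a xs \<longrightarrow> length xs \<le> 2) \<longrightarrow>
     encodes_instance n E prefers s \<longrightarrow> 4 * n + 10 \<le> 2 ^ w \<longrightarrow>
     (\<exists>t s' M. exec w program s t s' \<and> t \<le> a * n + b \<and>
        matching E M \<and> encodes_matching n M s' \<and> card (bp E prefers M) = min_bp E prefers)"
    using exec_program by blast
  then show ?thesis
    using affine_bigo[of a b] word_length_bigo word_length
    by (intro exI[of _ program] exI[of _ "\<lambda>n. a * n + b"] exI[of _ word_length]) blast
qed

end
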